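(* Let $\mathcal{A}, \mathcal{B}$ be unital $C^*$-algebras, let $\mathcal{C}$ be any unital $C^*$-algebra containing the algebraic tensor product $\mathcal{A} \otimes_{alg} \mathcal{B}$ (as a $*$-subalgebra), and let $n \geq 1$. If $R = [r_{ij}] \in M_n(\mathcal{A})^+$ and $S = [s_{ij}] \in M_n(\mathcal{B})^+$, then $$R \circ^\otimes S \in M_n(\mathcal{C})^+ .$$ In particular, $$\sum_{i,j=1}^n r_{ij} \otimes s_{ij} \in \mathcal{C}^+ .$$
   Context: For a $C^*$-algebra $\mathcal{D}$, $\mathcal{D}^+$ denotes its set of positive elements; $M_n(\mathcal{D})$ is the $C^*$-algebra of $n\times n$ matrices over $\mathcal{D}$, and $M_n(\mathcal{D})^+$ its set of positive elements. All $C^*$-algebras are assumed unital. $\mathcal{A} \otimes_{alg} \mathcal{B}$ is the algebraic tensor product, a $*$-algebra with the usual product and involution. For $R = [r_{ij}] \in M_n(\mathcal{A})$ and $S = [s_{ij}] \in M_n(\mathcal{B})$, the tensorial Schur product is $R \circ^\otimes S := [r_{ij} \otimes s_{ij}] \in M_n(\mathcal{A} \otimes_{alg} \mathcal{B})$, which is viewed as an element of $M_n(\mathcal{C})$ whenever $\mathcal{C}$ contains $\mathcal{A} \otimes_{alg} \mathcal{B}$. *)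

theory Defs
  imports "HOL-Analysis.Analysis" "HOL-Library.Poly_Mapping"
begin

section \<open>Complex *-algebras and unital C*-algebras\<close>

class complex_star_algebra = ring +
  fixes scaleC :: "complex \<Rightarrow> 'a \<Rightarrow> 'a"  (infixr \<open>*\<^sub>C\<close> 75)
    and star :: "'a \<Rightarrow> 'a"
  assumes scaleC_add_right: "z *\<^sub>C (x + y) = z *\<^sub>C x + z *\<^sub>C y"
    and scaleC_add_left: "(z + w) *\<^sub>C x = z *\<^sub>C x + w *\<^sub>C x"
    and scaleC_scaleC: "z *\<^sub>C (w *\<^sub>C x) = (z * w) *\<^sub>C x"
    and scaleC_one: "1 *\<^sub>C x = x"
    and mult_scaleC_left: "(z *\<^sub>C x) * y = z *\<^sub>C (x * y)"
    and mult_scaleC_right: "x * (z *\<^sub>C y) = z *\<^sub>C (x * y)"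
    and star_star: "star (star x) = x"
    and star_add: "star (x + y) = star x + star y"
    and star_scaleC: "star (z *\<^sub>C x) = cnj z *\<^sub>C star x"
    and star_mult: "star (x * y) = star y * star x"

class cstar_algebra = complex_star_algebra + real_normed_algebra_1 + banach +
  assumes scaleR_scaleC: "r *\<^sub>R x = complex_of_real r *\<^sub>C x"
    and norm_scaleC: "norm (z *\<^sub>C x) = cmod z * norm x"
    and cstar_identity: "norm (star x * x) = (norm x)\<^sup>2"

instantiation complex :: cstar_algebra
begin

definition scaleC_complex :: "complex \<Rightarrow> complex \<Rightarrow> complex"
  where "scaleC_complex z x = z * x"

definition star_complex :: "complex \<Rightarrow> complex"
  where "star_complex x = cnj x"

instance
  by standard
    (simp_all add: scaleC_complex_def star_complex_def algebra_simps scaleR_conv_of_real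
      norm_mult power2_eq_square)

end

section \<open>Positive elements\<close>

definition spectrum :: "'a::cstar_algebra \<Rightarrow> complex set"
  where "spectrum a = {z. \<not> (\<exists>b. (a - z *\<^sub>C 1) * b = 1 \<and> b * (a - z *\<^sub>C 1) = 1)}"

definition positive :: "'a::cstar_algebra \<Rightarrow> bool"
  where "positive a \<longleftrightarrow> star a = a \<and> spectrum a \<subseteq> \<real>\<^sub>\<ge>\<^sub>0"

text \<open>
  The C*-algebra of \<open>n \<times> n\<close> matrices is rendered by the type \<open>'a^'n^'n\<close> with the product
  \<open>(**)\<close> and the involution \<open>mat_star\<close> (the class-level product on \<open>'a^'n^'n\<close> is
  componentwise and is not used).  The spectrum, and hence positivity, depends only on the unital
  *-algebra structure, so the C*-norm on matrices does not occur.
\<close>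

definition mat_star :: "'a::cstar_algebra^'n^'n \<Rightarrow> 'a^'n^'n"
  where "mat_star A = (\<chi> i j. star (A $ j $ i))"

definition mat_spectrum :: "'a::cstar_algebra^'n^'n \<Rightarrow> complex set"
  where "mat_spectrum A = {z. \<not> invertible (A - mat (z *\<^sub>C 1))}"

definition mat_positive :: "'a::cstar_algebra^'n^'n \<Rightarrow> bool"
  where "mat_positive A \<longleftrightarrow> mat_star A = A \<and> mat_spectrum A \<subseteq> \<real>\<^sub>\<ge>\<^sub>0"

section \<open>The algebraic tensor product\<close>

text \<open>
  The free complex vector space on \<open>'a \<times> 'b\<close> consists of the finitely supported functions
  \<open>('a \<times> 'b) \<Rightarrow>\<^sub>0 complex\<close>.  Its product is the bilinear extension of the componentwise product
  of basis elements; the library's \<open>(*)\<close> on \<open>\<Rightarrow>\<^sub>0\<close> is a different operation.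
\<close>

definition free_scale :: "complex \<Rightarrow> ('p \<Rightarrow>\<^sub>0 complex) \<Rightarrow> ('p \<Rightarrow>\<^sub>0 complex)"
  where "free_scale z f = Poly_Mapping.map ((*) z) f"

definition free_mult ::
    "('a::times \<times> 'b::times \<Rightarrow>\<^sub>0 complex) \<Rightarrow> ('a \<times> 'b \<Rightarrow>\<^sub>0 complex) \<Rightarrow> ('a \<times> 'b \<Rightarrow>\<^sub>0 complex)"
  where "free_mult f g =
    (\<Sum>p\<in>Poly_Mapping.keys f. \<Sum>q\<in>Poly_Mapping.keys g.
       Poly_Mapping.single (fst p * fst q, snd p * snd q)
         (Poly_Mapping.lookup f p * Poly_Mapping.lookup g q))"

definition free_star ::
    "('a::complex_star_algebra \<times> 'b::complex_star_algebra \<Rightarrow>\<^sub>0 complex) \<Rightarrow> ('a \<times> 'b \<Rightarrow>\<^sub>0 complex)"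
  where "free_star f =
    (\<Sum>p\<in>Poly_Mapping.keys f.
       Poly_Mapping.single (star (fst p), star (snd p)) (cnj (Poly_Mapping.lookup f p)))"

text \<open>The linear span of the bilinearity relations.\<close>

inductive tensor_null ::
    "('a::complex_star_algebra \<times> 'b::complex_star_algebra \<Rightarrow>\<^sub>0 complex) \<Rightarrow> bool"
  where
    null_zero: "tensor_null 0"
  | null_add: "tensor_null f \<Longrightarrow> tensor_null g \<Longrightarrow> tensor_null (f + g)"
  | null_scale: "tensor_null f \<Longrightarrow> tensor_null (free_scale z f)"
  | rel_add_left: "tensor_null (Poly_Mapping.single (a + a', b) 1
      - Poly_Mapping.single (a, b) 1 - Poly_Mapping.single (a', b) 1)"
  | rel_add_right: "tensor_null (Poly_Mapping.single (a, b + b') 1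
      - Poly_Mapping.single (a, b) 1 - Poly_Mapping.single (a, b') 1)"
  | rel_scale_left: "tensor_null (Poly_Mapping.single (z *\<^sub>C a, b) 1 - Poly_Mapping.single (a, b) z)"
  | rel_scale_right: "tensor_null (Poly_Mapping.single (a, z *\<^sub>C b) 1 - Poly_Mapping.single (a, b) z)"

lemma lookup_free_scale [simp]:
  "Poly_Mapping.lookup (free_scale z f) p = z * Poly_Mapping.lookup f p"
  by (simp add: free_scale_def Poly_Mapping.map.rep_eq when_def)

lemma free_scale_simps:
  "free_scale z (f + g) = free_scale z f + free_scale z g"
  "free_scale z (f - g) = free_scale z f - free_scale z g"
  "free_scale (z + w) f = free_scale z f + free_scale w f"
  "free_scale z (free_scale w f) = free_scale (z * w) f"
  "free_scale 1 f = f"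
  "free_scale z 0 = 0"
  "free_scale (- 1) f = - f"
  "free_scale z (Poly_Mapping.single p c) = Poly_Mapping.single p (z * c)"
  by (rule poly_mapping_eqI;
      simp add: lookup_add lookup_minus lookup_single when_def algebra_simps)+

lemma tensor_null_uminus: "tensor_null f \<Longrightarrow> tensor_null (- f)"
  using null_scale[of f "- 1"] by (simp add: free_scale_simps)

lemma tensor_null_diff: "tensor_null f \<Longrightarrow> tensor_null g \<Longrightarrow> tensor_null (f - g)"
  using null_add[OF _ tensor_null_uminus, of f g] by simp

lemma free_induct [case_names zero single add]:
  fixes f :: "'p \<Rightarrow>\<^sub>0 complex"
  assumes "P 0" "\<And>p c. P (Poly_Mapping.single p c)" "\<And>f g. P f \<Longrightarrow> P g \<Longrightarrow> P (f + g)"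
  shows "P f"
proof -
  have "P (\<Sum>p\<in>A. Poly_Mapping.single p (Poly_Mapping.lookup f p))" if "finite A" for A
    using that by induction (auto intro: assms)
  moreover have "(\<Sum>p\<in>Poly_Mapping.keys f. Poly_Mapping.single p (Poly_Mapping.lookup f p)) = f"
    by (rule poly_mapping_eqI)
      (auto simp: lookup_sum lookup_single when_def in_keys_iff if_distrib cong: if_cong)
  ultimately show ?thesis
    by (metis finite_keys)
qed

lemma sum_keys_superset:
  fixes f :: "'p \<Rightarrow>\<^sub>0 complex" and h :: "'p \<Rightarrow> complex \<Rightarrow> 'c::comm_monoid_add"
  assumes "\<And>p. h p 0 = 0" "finite A" "Poly_Mapping.keys f \<subseteq> A"
  shows "(\<Sum>p\<in>Poly_Mapping.keys f. h p (Poly_Mapping.lookup f p))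
    = (\<Sum>p\<in>A. h p (Poly_Mapping.lookup f p))"
  by (rule sum.mono_neutral_left) (use assms in \<open>auto simp: in_keys_iff\<close>)

lemma sum_keys_add:
  fixes f g :: "'p \<Rightarrow>\<^sub>0 complex" and h :: "'p \<Rightarrow> complex \<Rightarrow> 'c::comm_monoid_add"
  assumes 0: "\<And>p. h p 0 = 0" and "\<And>p c d. h p (c + d) = h p c + h p d"
  shows "(\<Sum>p\<in>Poly_Mapping.keys (f + g). h p (Poly_Mapping.lookup (f + g) p))
    = (\<Sum>p\<in>Poly_Mapping.keys f. h p (Poly_Mapping.lookup f p))
      + (\<Sum>p\<in>Poly_Mapping.keys g. h p (Poly_Mapping.lookup g p))"
proof -
  let ?A = "Poly_Mapping.keys f \<union> Poly_Mapping.keys g"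
  have A: "finite ?A" "Poly_Mapping.keys f \<subseteq> ?A" "Poly_Mapping.keys g \<subseteq> ?A"
    "Poly_Mapping.keys (f + g) \<subseteq> ?A"
    using Poly_Mapping.keys_add[of f g] by auto
  show ?thesis
    using sum_keys_superset[of h, OF 0 A(1,2)] sum_keys_superset[of h, OF 0 A(1,3)]
      sum_keys_superset[of h, OF 0 A(1,4)]
    by (simp add: lookup_add assms(2) sum.distrib)
qed

lemma sum_keys_single:
  fixes h :: "'p \<Rightarrow> complex \<Rightarrow> 'c::comm_monoid_add"
  assumes "\<And>p. h p 0 = 0"
  shows "(\<Sum>q\<in>Poly_Mapping.keys (Poly_Mapping.single p c).
      h q (Poly_Mapping.lookup (Poly_Mapping.single p c) q)) = h p c"
  by (cases "c = 0") (simp_all add: assms)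

lemma free_mult_zero [simp]: "free_mult 0 g = 0" "free_mult f 0 = 0"
  by (simp_all add: free_mult_def)

lemma free_mult_add_left: "free_mult (f + f') g = free_mult f g + free_mult f' g"
  unfolding free_mult_def
  by (rule sum_keys_add) (simp_all add: distrib_right single_add sum.distrib)

lemma free_mult_add_right: "free_mult f (g + g') = free_mult f g + free_mult f g'"
proof -
  have "(\<Sum>q\<in>Poly_Mapping.keys (g + g'). Poly_Mapping.single (fst p * fst q, snd p * snd q)
         (c * Poly_Mapping.lookup (g + g') q))
    = (\<Sum>q\<in>Poly_Mapping.keys g. Poly_Mapping.single (fst p * fst q, snd p * snd q)
         (c * Poly_Mapping.lookup g q))
    + (\<Sum>q\<in>Poly_Mapping.keys g'. Poly_Mapping.single (fst p * fst q, snd p * snd q)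
         (c * Poly_Mapping.lookup g' q))" for p c
    by (rule sum_keys_add) (simp_all add: distrib_left single_add)
  then show ?thesis
    by (simp add: free_mult_def sum.distrib)
qed

lemma free_mult_single:
  "free_mult (Poly_Mapping.single p c) (Poly_Mapping.single q d)
    = Poly_Mapping.single (fst p * fst q, snd p * snd q) (c * d)"
  by (cases "c = 0"; cases "d = 0") (simp_all add: free_mult_def)

lemma free_mult_scale_left: "free_mult (free_scale z f) g = free_scale z (free_mult f g)"
proof (induction f rule: free_induct)
  case (single p c)
  show ?case
    by (induction g rule: free_induct)
      (simp_all add: free_scale_simps free_mult_single free_mult_add_right mult.assoc)
qed (simp_all add: free_scale_simps free_mult_add_left)

lemma free_mult_scale_right: "free_mult f (free_scale z g) = free_scale z (free_mult f g)"
proof (induction f rule: free_induct)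
  case (single p c)
  show ?case
    by (induction g rule: free_induct)
      (simp_all add: free_scale_simps free_mult_single free_mult_add_right mult.left_commute)
qed (simp_all add: free_scale_simps free_mult_add_left)

lemma free_mult_uminus:
  "free_mult (- f) g = - free_mult f g" "free_mult f (- g) = - free_mult f g"
  using free_mult_scale_left[of "- 1" f g] free_mult_scale_right[of f "- 1" g]
  by (simp_all add: free_scale_simps)

lemma free_mult_diff_left: "free_mult (f - f') g = free_mult f g - free_mult f' g"
  using free_mult_add_left[of f "- f'" g] by (simp add: free_mult_uminus)

lemma free_mult_diff_right: "free_mult f (g - g') = free_mult f g - free_mult f g'"
  using free_mult_add_right[of f g "- g'"] by (simp add: free_mult_uminus)

lemma free_mult_assoc:
  fixes f g h :: "'a::semigroup_mult \<times> 'b::semigroup_mult \<Rightarrow>\<^sub>0 complex"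
  shows "free_mult (free_mult f g) h = free_mult f (free_mult g h)"
proof (induction f rule: free_induct)
  case f: (single p c)
  show ?case
  proof (induction g rule: free_induct)
    case (single q d)
    show ?case
      by (induction h rule: free_induct)
        (simp_all add: free_mult_single free_mult_add_right mult.assoc)
  qed (simp_all add: free_mult_add_right free_mult_add_left)
qed (simp_all add: free_mult_add_left)

lemma free_star_zero [simp]: "free_star 0 = 0"
  by (simp add: free_star_def)

lemma free_star_add: "free_star (f + g) = free_star f + free_star g"
  unfolding free_star_def by (rule sum_keys_add) (simp_all add: single_add)

lemma free_star_single:
  "free_star (Poly_Mapping.single p c) = Poly_Mapping.single (star (fst p), star (snd p)) (cnj c)"
  by (cases "c = 0") (simp_all add: free_star_def)

lemma free_star_scale: "free_star (free_scale z f) = free_scale (cnj z) (free_star f)"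
  by (induction f rule: free_induct)
    (simp_all add: free_scale_simps free_star_single free_star_add)

lemma free_star_diff: "free_star (f - g) = free_star f - free_star g"
  using free_star_add[of f "- g"] free_star_scale[of "- 1" g] by (simp add: free_scale_simps)

lemma free_star_star: "free_star (free_star f) = f"
  by (induction f rule: free_induct) (simp_all add: free_star_single free_star_add star_star)

lemma free_star_mult: "free_star (free_mult f g) = free_mult (free_star g) (free_star f)"
proof (induction f rule: free_induct)
  case (single p c)
  show ?case
    by (induction g rule: free_induct)
      (simp_all add: free_mult_single free_star_single free_star_add free_mult_add_left
        free_mult_add_right star_mult mult.commute)
qed (simp_all add: free_mult_add_left free_mult_add_right free_star_add)

lemma tensor_null_rels_scaled:
  "tensor_null (Poly_Mapping.single (a + a', b) w
      - Poly_Mapping.single (a, b) w - Poly_Mapping.single (a', b) w)"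
  "tensor_null (Poly_Mapping.single (a, b + b') w
      - Poly_Mapping.single (a, b) w - Poly_Mapping.single (a, b') w)"
  "tensor_null (Poly_Mapping.single (z *\<^sub>C a, b) w - Poly_Mapping.single (a, b) (w * z))"
  "tensor_null (Poly_Mapping.single (a, z *\<^sub>C b) w - Poly_Mapping.single (a, b) (w * z))"
  using null_scale[OF rel_add_left[of a a' b], of w] null_scale[OF rel_add_right[of a b b'], of w]
    null_scale[OF rel_scale_left[of z a b], of w] null_scale[OF rel_scale_right[of a z b], of w]
  by (simp_all add: free_scale_simps)

lemma tensor_null_mult_left: "tensor_null f \<Longrightarrow> tensor_null (free_mult f g)"
proof (induction g arbitrary: f rule: free_induct)
  case (single q d)
  then show ?case
    by induction
      (simp_all add: null_zero null_add null_scale free_mult_add_left free_mult_scale_left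
        free_mult_diff_left free_mult_single distrib_right mult_scaleC_left mult.commute[of _ d]
        tensor_null_rels_scaled)
qed (simp_all add: null_zero null_add free_mult_add_right)

lemma tensor_null_star: "tensor_null f \<Longrightarrow> tensor_null (free_star f)"
proof (induction rule: tensor_null.induct)
  case (rel_scale_left z a b)
  show ?case
    using tensor_null_rels_scaled(3)[of "cnj z" "star a" "star b" 1]
    by (simp add: free_star_diff free_star_single star_scaleC)
next
  case (rel_scale_right a z b)
  show ?case
    using tensor_null_rels_scaled(4)[of "star a" "cnj z" "star b" 1]
    by (simp add: free_star_diff free_star_single star_scaleC)
qed (simp_all add: null_zero null_add null_scale free_star_add free_star_scale free_star_diff
      free_star_single star_add tensor_null_rels_scaled)

lemma tensor_null_mult_right: "tensor_null g \<Longrightarrow> tensor_null (free_mult f g)"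
  using tensor_null_star[OF tensor_null_mult_left[OF tensor_null_star], of g "free_star f"]
  by (simp add: free_star_mult free_star_star)

quotient_type (overloaded) ('a, 'b) alg_tensor =
    "'a::complex_star_algebra \<times> 'b::complex_star_algebra \<Rightarrow>\<^sub>0 complex"
    / "\<lambda>f g. tensor_null (f - g)"
proof (rule equivpI)
  show "reflp (\<lambda>f g :: 'a \<times> 'b \<Rightarrow>\<^sub>0 complex. tensor_null (f - g))"
    by (simp add: reflp_def null_zero)
  show "symp (\<lambda>f g :: 'a \<times> 'b \<Rightarrow>\<^sub>0 complex. tensor_null (f - g))"
    using tensor_null_uminus by (force simp: symp_def)
  show "transp (\<lambda>f g :: 'a \<times> 'b \<Rightarrow>\<^sub>0 complex. tensor_null (f - g))"
    using null_add by (force simp: transp_def)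
qed

instantiation alg_tensor :: (complex_star_algebra, complex_star_algebra) complex_star_algebra
begin

lift_definition zero_alg_tensor :: "('a, 'b) alg_tensor" is 0 .

lift_definition plus_alg_tensor :: "('a, 'b) alg_tensor \<Rightarrow> ('a, 'b) alg_tensor \<Rightarrow> ('a, 'b) alg_tensor"
  is "(+)"
  using null_add by (force simp: algebra_simps)

lift_definition uminus_alg_tensor :: "('a, 'b) alg_tensor \<Rightarrow> ('a, 'b) alg_tensor"
  is uminus
  using tensor_null_uminus by force

lift_definition minus_alg_tensor :: "('a, 'b) alg_tensor \<Rightarrow> ('a, 'b) alg_tensor \<Rightarrow> ('a, 'b) alg_tensor"
  is "(-)"
  using tensor_null_diff by (force simp: algebra_simps)

lift_definition scaleC_alg_tensor :: "complex \<Rightarrow> ('a, 'b) alg_tensor \<Rightarrow> ('a, 'b) alg_tensor"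
  is free_scale
  using null_scale by (force simp: free_scale_simps(2)[symmetric])

lift_definition times_alg_tensor :: "('a, 'b) alg_tensor \<Rightarrow> ('a, 'b) alg_tensor \<Rightarrow> ('a, 'b) alg_tensor"
  is free_mult
proof -
  fix f f' g g' :: "'a \<times> 'b \<Rightarrow>\<^sub>0 complex"
  assume "tensor_null (f - f')" "tensor_null (g - g')"
  then have "tensor_null (free_mult (f - f') g + free_mult f' (g - g'))"
    by (intro null_add tensor_null_mult_left tensor_null_mult_right)
  then show "tensor_null (free_mult f g - free_mult f' g')"
    by (simp add: free_mult_diff_left free_mult_diff_right)
qed

lift_definition star_alg_tensor :: "('a, 'b) alg_tensor \<Rightarrow> ('a, 'b) alg_tensor"
  is free_star
  using tensor_null_star by (force simp: free_star_diff[symmetric])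

instance
proof
  fix x y z :: "('a, 'b) alg_tensor" and c d :: complex
  show "x + y + z = x + (y + z)" "x + y = y + x" "0 + x = x" "- x + x = 0" "x - y = x + - y"
    by (transfer; simp add: algebra_simps null_zero)+
  show "x * y * z = x * (y * z)"
    by transfer (simp add: free_mult_assoc null_zero)
  show "(x + y) * z = x * z + y * z" "x * (y + z) = x * y + x * z"
    by (transfer; simp add: free_mult_add_left free_mult_add_right null_zero)+
  show "c *\<^sub>C (x + y) = c *\<^sub>C x + c *\<^sub>C y" "(c + d) *\<^sub>C x = c *\<^sub>C x + d *\<^sub>C x"
    "c *\<^sub>C (d *\<^sub>C x) = (c * d) *\<^sub>C x" "1 *\<^sub>C x = x"
    by (transfer; simp add: free_scale_simps null_zero)+
  show "(c *\<^sub>C x) * y = c *\<^sub>C (x * y)" "x * (c *\<^sub>C y) = c *\<^sub>C (x * y)"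
    by (transfer; simp add: free_mult_scale_left free_mult_scale_right null_zero)+
  show "star (star x) = x" "star (x + y) = star x + star y"
    "star (c *\<^sub>C x) = cnj c *\<^sub>C star x" "star (x * y) = star y * star x"
    by (transfer; simp add: free_star_star free_star_add free_star_scale free_star_mult null_zero)+
qed

end

lift_definition pure_tensor ::
    "'a::complex_star_algebra \<Rightarrow> 'b::complex_star_algebra \<Rightarrow> ('a, 'b) alg_tensor"
    (infixl \<open>\<otimes>\<close> 70)
  is "\<lambda>a b. Poly_Mapping.single (a, b) 1" .

lemma pure_tensor_simps:
  "(a + a') \<otimes> b = a \<otimes> b + a' \<otimes> b"
  "a \<otimes> (b + b') = a \<otimes> b + a \<otimes> b'"
  "(z *\<^sub>C a) \<otimes> b = z *\<^sub>C (a \<otimes> b)"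
  "a \<otimes> (z *\<^sub>C b) = z *\<^sub>C (a \<otimes> b)"
  "(a \<otimes> b) * (c \<otimes> d) = (a * c) \<otimes> (b * d)"
  "star (a \<otimes> b) = star a \<otimes> star b"
  subgoal
    by transfer (metis diff_diff_eq rel_add_left)
  subgoal
    by transfer (metis diff_diff_eq rel_add_right)
  subgoal
    by transfer (simp add: free_scale_simps rel_scale_left)
  subgoal
    by transfer (simp add: free_scale_simps rel_scale_right)
  subgoal
    by transfer (simp add: free_mult_single null_zero)
  subgoal
    by transfer (simp add: free_star_single null_zero)
  done

section \<open>*-homomorphisms and the tensorial Schur product\<close>

text \<open>*-homomorphisms are not required to preserve units.\<close>

definition star_hom :: "('a::complex_star_algebra \<Rightarrow> 'b::complex_star_algebra) \<Rightarrow> bool"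
  where "star_hom \<phi> \<longleftrightarrow>
    (\<forall>x y. \<phi> (x + y) = \<phi> x + \<phi> y) \<and>
    (\<forall>z x. \<phi> (z *\<^sub>C x) = z *\<^sub>C \<phi> x) \<and>
    (\<forall>x y. \<phi> (x * y) = \<phi> x * \<phi> y) \<and>
    (\<forall>x. \<phi> (star x) = star (\<phi> x))"

definition tensor_schur ::
    "'a::complex_star_algebra^'n^'n \<Rightarrow> 'b::complex_star_algebra^'n^'n \<Rightarrow> ('a, 'b) alg_tensor^'n^'n"
    (infixl \<open>\<circ>\<^sup>\<otimes>\<close> 70)
  where "R \<circ>\<^sup>\<otimes> S = (\<chi> i j. (R $ i $ j) \<otimes> (S $ i $ j))"

end

theory Submission
  imports Defs
begin

text \<open>
  Factor \<open>R = X\<^sup>* X\<close> and \<open>S = Y\<^sup>* Y\<close> over the two matrix algebras. Since \<open>\<iota>\<close> is multiplicative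
  and *-preserving, the elements \<open>z\<^bsub>l k j\<^esub> = \<iota> (x\<^bsub>k j\<^esub> \<otimes> y\<^bsub>l j\<^esub>)\<close> satisfy
  \<open>\<iota> (r\<^bsub>i j\<^esub> \<otimes> s\<^bsub>i j\<^esub>) = (\<Sum>l k. z\<^bsub>l k i\<^esub>\<^sup>* z\<^bsub>l k j\<^esub>)\<close>. So the image of the Schur product is
  the sum over \<open>l\<close> of the matrices \<open>Z\<^sub>l\<^sup>* Z\<^sub>l\<close>, and the sum of its entries is the sum over \<open>l\<close>
  and \<open>k\<close> of the elements \<open>w\<^sup>* w\<close> with \<open>w = (\<Sum>j. z\<^bsub>l k j\<^esub>)\<close>.

  What has to be supplied is the theory of positive elements behind this computation: in a
  unital C*-algebra a positive element has a positive square root (\<open>positive_sqrt\<close>), sums of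
  positive elements are positive (\<open>positive_add\<close>), and every \<open>x\<^sup>* x\<close> is positive
  (\<open>positive_star_mult\<close>). All of it depends on one spectral fact, that the spectrum of a
  self-adjoint element contains a point of modulus equal to the norm
  (\<open>spectral_radius_attained\<close>). This fact turns positivity into the metric condition
  \<open>\<parallel>t - a\<parallel> \<le> t\<close> on a self-adjoint \<open>a\<close>, for some \<open>t\<close>, which is visibly stable under sums and
  under which a square root is the limit of a simple iteration.

  To use the theory for matrices, the square matrices over a C*-algebra have to form a
  C*-algebra themselves. Their norm is the operator norm on columns, where the column \<open>x\<close> has
  the algebra-valued square \<open>\<langle>x, x\<rangle> = (\<Sum>i. x\<^sub>i\<^sup>* x\<^sub>i)\<close>: the norm of \<open>A\<close> is the infimum of all
  \<open>t > 0\<close> such that \<open>t\<^sup>2 \<langle>x, x\<rangle> - \<langle>A x, A x\<rangle>\<close> is positive for every \<open>x\<close>. The axioms of a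
  C*-norm then follow from identities between such algebra-valued squares, without a
  Cauchy-Schwarz inequality.
\<close>

section \<open>Elementary properties of the involution\<close>

interpretation scaleC: vector_space "scaleC :: complex \<Rightarrow> 'a::complex_star_algebra \<Rightarrow> 'a"
  by standard (simp_all add: scaleC_add_right scaleC_add_left scaleC_scaleC scaleC_one)

lemma star_zero [simp]: "star (0::'a::complex_star_algebra) = 0"
  using star_add[of "0::'a" 0] by simp

lemma star_minus: "star (- x) = - star (x::'a::complex_star_algebra)"
  using star_add[of x "- x"] by (simp add: eq_neg_iff_add_eq_0 add.commute)

lemma star_diff: "star (x - y) = star x - star (y::'a::complex_star_algebra)"
  using star_add[of x "- y"] by (simp add: star_minus)

lemma star_sum: "star (\<Sum>i\<in>I. f i) = (\<Sum>i\<in>I. star (f i :: 'a::complex_star_algebra))"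
  by (induction I rule: infinite_finite_induct) (simp_all add: star_add)

lemma star_one [simp]: "star (1::'a::cstar_algebra) = 1"
  by (metis mult.left_neutral mult.right_neutral star_mult star_star)

lemma star_scaleR: "star (r *\<^sub>R x) = r *\<^sub>R star (x::'a::cstar_algebra)"
  by (simp add: scaleR_scaleC star_scaleC)

lemma norm_star [simp]: "norm (star x) = norm (x::'a::cstar_algebra)"
proof -
  have *: "norm y \<le> norm (star y)" for y :: 'a
  proof (cases "y = 0")
    case False
    have "norm y * norm y \<le> norm (star y) * norm y"
      using norm_mult_ineq[of "star y" y] by (simp add: cstar_identity power2_eq_square)
    then show ?thesis
      using False by simp
  qed simp
  show ?thesis
    using *[of x] *[of "star x"] by (simp add: star_star)
qed

lemma bounded_linear_star: "bounded_linear (star :: 'a::cstar_algebra \<Rightarrow> 'a)"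
  by (rule bounded_linear_intro[where K = 1]) (simp_all add: star_add star_scaleR)

lemma cstar_eq_0_iff: "star x * x = 0 \<longleftrightarrow> (x::'a::cstar_algebra) = 0"
  using cstar_identity[of x] by auto

section \<open>Invertible elements and the spectrum\<close>

definition inverses :: "'a::ring_1 \<Rightarrow> 'a \<Rightarrow> bool"
  where "inverses x y \<longleftrightarrow> x * y = 1 \<and> y * x = 1"

lemma in_spectrum_iff: "z \<in> spectrum a \<longleftrightarrow> (\<nexists>b. inverses (a - z *\<^sub>C 1) b)"
  by (simp add: spectrum_def inverses_def)

lemma inverses_unique: "inverses x y \<Longrightarrow> inverses x z \<Longrightarrow> y = z"
  unfolding inverses_def by (metis mult.assoc mult.left_neutral mult.right_neutral)

lemma inverses_scaleC:
  assumes "inverses x y" "z \<noteq> 0"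
  shows "inverses (z *\<^sub>C x) (inverse z *\<^sub>C (y::'a::cstar_algebra))"
  using assms by (simp add: inverses_def mult_scaleC_left mult_scaleC_right scaleC_scaleC scaleC_one)

lemma scaleC_spectrum_iff:
  assumes "x = w *\<^sub>C (a - z *\<^sub>C 1)" "w \<noteq> 0"
  shows "z \<in> spectrum a \<longleftrightarrow> (\<nexists>b. inverses x b)"
proof -
  have "a - z *\<^sub>C 1 = inverse w *\<^sub>C x"
    using assms by (simp add: scaleC_scaleC scaleC_one)
  then show ?thesis
    unfolding in_spectrum_iff
    using inverses_scaleC[of x _ "inverse w"] inverses_scaleC[of "a - z *\<^sub>C 1" _ w] assms by auto
qed

text \<open>
  If \<open>u\<close> were the Neumann series \<open>1 + pq + pqpq + \<dots>\<close>, then \<open>1 + q u p\<close> would be the Neumann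
  series of \<open>q p\<close>; the resulting formula needs no convergence. It shows that \<open>p q\<close> and \<open>q p\<close>
  have the same non-zero spectrum.
\<close>

lemma inverses_one_minus_swap:
  fixes p q u :: "'a::ring_1"
  assumes "inverses (1 - p * q) u"
  shows "inverses (1 - q * p) (1 + q * u * p)"
proof -
  have a: "u = 1 + p * q * u" "u = 1 + u * p * q"
    using assms by (simp_all add: inverses_def algebra_simps)
  have "(1 - q * p) * (1 + q * u * p) = 1 - q * p + q * (u - p * q * u) * p"
    by (simp add: algebra_simps)
  also have "u - p * q * u = 1" using a(1) by (simp add: algebra_simps)
  finally have 1: "(1 - q * p) * (1 + q * u * p) = 1" by simp
  have "(1 + q * u * p) * (1 - q * p) = 1 - q * p + q * (u - u * p * q) * p"
    by (simp add: algebra_simps)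
  also have "u - u * p * q = 1" using a(2) by (simp add: algebra_simps)
  finally show ?thesis using 1 by (simp add: inverses_def)
qed

lemma inverses_one_minus_ex:
  fixes x :: "'a::cstar_algebra"
  assumes "norm x < 1"
  shows "\<exists>y. inverses (1 - x) y"
proof -
  have s: "summable (\<lambda>n. x ^ n)"
    by (rule summable_comparison_test'[of "\<lambda>n. norm x ^ n" 0])
      (use assms in \<open>auto simp: norm_power_ineq\<close>)
  define y where "y = suminf (\<lambda>n. x ^ n)"
  have "y = 1 + suminf (\<lambda>n. x ^ Suc n)"
    unfolding y_def using suminf_split_head[OF s] by simp
  moreover have "suminf (\<lambda>n. x ^ Suc n) = x * y" "suminf (\<lambda>n. x ^ Suc n) = y * x"
    unfolding y_def using suminf_mult[OF s, of x] suminf_mult2[OF s, of x]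
    by (simp_all add: power_commutes)
  ultimately show ?thesis
    by (intro exI[of _ y]) (simp add: inverses_def algebra_simps)
qed

lemma spectrum_norm_bound:
  fixes a :: "'a::cstar_algebra"
  assumes "z \<in> spectrum a"
  shows "cmod z \<le> norm a"
proof (rule ccontr)
  assume less: "\<not> cmod z \<le> norm a"
  then have "z \<noteq> 0" by auto
  then have "norm (inverse z *\<^sub>C a) < 1"
    using less by (simp add: norm_scaleC norm_inverse inverse_eq_divide norm_divide)
  then obtain y where "inverses (1 - inverse z *\<^sub>C a) y"
    using inverses_one_minus_ex by blast
  moreover have "1 - inverse z *\<^sub>C a = (- inverse z) *\<^sub>C (a - z *\<^sub>C 1)"
    using \<open>z \<noteq> 0\<close> by (simp add: scaleC.scale_right_diff_distrib scaleC_scaleC scaleC_one)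
  ultimately show False
    using scaleC_spectrum_iff[of _ "- inverse z" a z] assms \<open>z \<noteq> 0\<close> by auto
qed

text \<open>
  The resolvent identity \<open>y' - y = y' (x - x') y\<close> first bounds the norm of \<open>y'\<close> by twice that
  of \<open>y\<close>, and then the difference. This is the quantitative form of the continuity of
  inversion.
\<close>

lemma norm_inverses_diff:
  fixes x y x' y' :: "'a::cstar_algebra"
  assumes "inverses x y" "inverses x' y'" "norm (x - x') * norm y \<le> 1 / 2"
  shows "norm (y' - y) \<le> 2 * (norm y)\<^sup>2 * norm (x - x')"
proof -
  have "y' - y = y' * (x - x') * y"
    using assms(1,2) unfolding inverses_def
    by (simp add: algebra_simps)
  then have "norm (y' - y) \<le> norm y' * norm (x - x') * norm y"
    using norm_mult_ineq[of "y' * (x - x')" y] mult_right_mono[OF norm_mult_ineq[of y' "x - x'"]]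
    by (metis norm_ge_zero order_trans)
  then have d: "norm (y' - y) \<le> norm y' * (norm (x - x') * norm y)"
    by (simp add: mult.assoc)
  then have "norm y' - norm y \<le> norm y' * (1 / 2)"
    using mult_left_mono[OF assms(3), of "norm y'"] norm_triangle_ineq2[of y' y] by simp
  then have "norm y' * (norm (x - x') * norm y) \<le> (2 * norm y) * (norm (x - x') * norm y)"
    by (intro mult_right_mono) auto
  with d show ?thesis by (simp add: power2_eq_square mult_ac)
qed

section \<open>The spectral radius of a self-adjoint element\<close>

definition elem_inv :: "'a::ring_1 \<Rightarrow> 'a"
  where "elem_inv x = (SOME y. inverses x y)"

lemma elem_inv_eq: "inverses x y \<Longrightarrow> elem_inv x = y"
  unfolding elem_inv_def by (rule some_equality) (auto dest: inverses_unique)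

lemma continuous_on_elem_inv:
  fixes f :: "'z::metric_space \<Rightarrow> 'a::cstar_algebra"
  assumes f: "continuous_on S f" and inv: "\<And>z. z \<in> S \<Longrightarrow> \<exists>y. inverses (f z) y"
  shows "continuous_on S (\<lambda>z. elem_inv (f z))"
  unfolding continuous_on_def
proof
  fix z assume z: "z \<in> S"
  obtain y where y: "inverses (f z) y" using inv z by blast
  have lim: "((\<lambda>w. norm (f z - f w)) \<longlongrightarrow> 0) (at z within S)"
  proof -
    have "((\<lambda>w. norm (f z - f w)) \<longlongrightarrow> norm (f z - f z)) (at z within S)"
      using f z unfolding continuous_on_def by (intro tendsto_intros) blast
    then show ?thesis by simp
  qed
  have "((\<lambda>w. norm (f z - f w) * norm y) \<longlongrightarrow> 0) (at z within S)"
    using tendsto_mult_left_zero[OF lim] .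
  then have "\<forall>\<^sub>F w in at z within S. norm (f z - f w) * norm y < 1 / 2"
    by (rule order_tendstoD) simp
  moreover have "\<forall>\<^sub>F w in at z within S. w \<in> S"
    by (simp add: eventually_at_filter)
  ultimately have "\<forall>\<^sub>F w in at z within S.
      norm (elem_inv (f w) - elem_inv (f z)) \<le> norm (f z - f w) * (2 * (norm y)\<^sup>2)"
  proof eventually_elim
    case (elim w)
    then obtain y' where y': "inverses (f w) y'" using inv by blast
    show ?case
      using norm_inverses_diff[OF y y'] elim(1) elem_inv_eq[OF y] elem_inv_eq[OF y']
      by (simp add: mult_ac)
  qed
  then have "((\<lambda>w. elem_inv (f w) - elem_inv (f z)) \<longlongrightarrow> 0) (at z within S)"
    by (rule Lim_null_comparison[OF _ tendsto_mult_left_zero[OF lim]])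
  then show "((\<lambda>w. elem_inv (f w)) \<longlongrightarrow> elem_inv (f z)) (at z within S)"
    by (rule LIM_zero_cancel)
qed

text \<open>
  Partial fractions: \<open>(1 - b\<^sup>2)\<^bsup>-1\<^esup>\<close> is the mean of \<open>(1 - b)\<^bsup>-1\<^esup>\<close> and \<open>(1 + b)\<^bsup>-1\<^esup>\<close>.
\<close>

lemma inverses_one_minus_square:
  fixes b :: "'a::cstar_algebra"
  assumes "inverses (1 - b) c" "inverses (1 + b) d"
  shows "inverses (1 - b * b) ((1 / 2) *\<^sub>R (c + d))"
proof -
  have p: "1 - b * b = (1 - b) * (1 + b)" "1 - b * b = (1 + b) * (1 - b)"
    by (simp_all add: algebra_simps)
  have "(1 + b) * ((1 - b) * c) = 1 + b" "(1 - b) * ((1 + b) * d) = 1 - b"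
    "(c * (1 - b)) * (1 + b) = 1 + b" "(d * (1 + b)) * (1 - b) = 1 - b"
    using assms by (simp_all add: inverses_def)
  then have "(1 - b * b) * c = 1 + b" "(1 - b * b) * d = 1 - b"
    "c * (1 - b * b) = 1 + b" "d * (1 - b * b) = 1 - b"
    by (metis p mult.assoc)+
  moreover have "(1 / 2) *\<^sub>R ((1 + b) + (1 - b)) = 1"
    by (simp add: scaleR_2[symmetric])
  ultimately show ?thesis
    by (simp add: inverses_def distrib_left distrib_right)
qed

lemma bounded_linear_scaleC_left: "bounded_linear (\<lambda>z. z *\<^sub>C (a::'a::cstar_algebra))"
proof (rule bounded_linear_intro[where K = "norm a"])
  show "(r *\<^sub>R z) *\<^sub>C a = r *\<^sub>R (z *\<^sub>C a)" for r z
    unfolding scaleR_scaleC[of r "z *\<^sub>C a"] scaleC_scaleC scaleR_conv_of_real[of r z] ..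
qed (simp_all add: scaleC_add_left norm_scaleC)

definition iter_square :: "nat \<Rightarrow> 'a::monoid_mult \<Rightarrow> 'a"
  where "iter_square k b = b ^ (2 ^ k)"

lemma iter_square_Suc: "iter_square (Suc k) b = iter_square k b * iter_square k b"
  by (simp add: iter_square_def power_add[symmetric] mult_2)

lemma iter_square_0 [simp]: "iter_square 0 b = b"
  by (simp add: iter_square_def)

lemma star_sqpow: "star b = b \<Longrightarrow> star (iter_square k b) = iter_square k (b::'a::cstar_algebra)"
  by (induction k) (simp_all add: iter_square_Suc star_mult)

lemma norm_sqpow:
  assumes "star b = b"
  shows "norm (iter_square k b) = norm (b::'a::cstar_algebra) ^ (2 ^ k)"
proof (induction k)
  case (Suc k)
  then show ?case
    using cstar_identity[of "iter_square k b"] star_sqpow[OF assms, of k]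
    by (simp add: iter_square_Suc power_mult power2_eq_square power_add[symmetric] mult_2)
qed simp

text \<open>
  Suppose that \<open>(1 - w b)\<^bsup>-1\<^esup>\<close> exists on the closed unit disc; it is then uniformly continuous
  there, so replacing \<open>w\<close> by \<open>r w\<close> with \<open>r < 1\<close> close to \<open>1\<close> changes it by at most \<open>1 / 8\<close> on
  the unit circle. By the partial fraction identity the same bound passes from \<open>b\<close> to \<open>b\<^sup>2\<close>,
  with \<open>r\<^sup>2\<close> in place of \<open>r\<close>, since a mean of two such differences is again bounded by
  \<open>1 / 8\<close>. Iterating, it holds for \<open>c = b ^ (2 ^ n)\<close> and \<open>r ^ (2 ^ n)\<close>. But the latter tends
  to \<open>0\<close>, so \<open>(1 - c)\<^bsup>-1\<^esup>\<close> is close to \<open>1\<close>, which forces the norm of \<open>c\<close> to be smaller than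
  \<open>1\<close>. For self-adjoint \<open>b\<close> of norm \<open>1\<close> this norm is \<open>1\<close>.
\<close>

lemma unit_disc_resolvent_singular:
  fixes b :: "'a::cstar_algebra"
  assumes sa: "star b = b" and nb: "norm b = 1"
  shows "\<exists>w. cmod w \<le> 1 \<and> (\<nexists>y. inverses (1 - w *\<^sub>C b) y)"
proof (rule ccontr)
  assume "\<not> ?thesis"
  then have inv: "\<exists>y. inverses (1 - w *\<^sub>C b) y" if "cmod w \<le> 1" for w
    using that by blast
  define G where "G = (\<lambda>w. elem_inv (1 - w *\<^sub>C b))"
  have "continuous_on (cball 0 1) G"
    unfolding G_def
    by (intro continuous_on_elem_inv continuous_intros
        bounded_linear.continuous_on[OF bounded_linear_scaleC_left]) (use inv in auto)
  then have "uniformly_continuous_on (cball 0 1) G"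
    by (rule compact_uniformly_continuous) simp
  then obtain \<delta> where \<delta>: "\<delta> > 0"
    "\<And>w w'. \<lbrakk>cmod w \<le> 1; cmod w' \<le> 1; dist w' w < \<delta>\<rbrakk> \<Longrightarrow> dist (G w') (G w) < 1 / 8"
    unfolding uniformly_continuous_on_def
    by (metis (no_types, opaque_lifting) dist_0_norm mem_cball zero_less_divide_1_iff zero_less_numeral)
  define r where "r = 1 - min \<delta> 1 / 2"
  have r: "0 < r" "r < 1" "1 - r < \<delta>"
    using \<delta>(1) by (auto simp: r_def min_def)
  have rk: "0 \<le> iter_square k r" "iter_square k r \<le> 1" for k
    using r by (auto simp: iter_square_def intro: power_le_one)
  let ?P = "\<lambda>k (w::complex). \<exists>y y'. inverses (1 - w *\<^sub>C iter_square k b) y \<and>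
      inverses (1 - (iter_square k r * w) *\<^sub>C iter_square k b) y' \<and> norm (y - y') \<le> 1 / 8"
  have *: "?P k w" if "cmod w = 1" for k and w :: complex
    using that
  proof (induction k arbitrary: w)
    case 0
    have 1: "cmod w \<le> 1" "cmod (r * w) \<le> 1" using 0 r by (simp_all add: norm_mult)
    have "r * w - w = of_real (r - 1) * w" by (simp add: algebra_simps)
    then have "dist (r * w) w = \<bar>r - 1\<bar>"
      unfolding dist_norm using 0 by (simp only: norm_mult norm_of_real mult_1_right)
    then have "dist (r * w) w < \<delta>" using r by simp
    then have "norm (G w - G (r * w)) \<le> 1 / 8"
      using \<delta>(2)[OF 1] by (simp add: dist_norm norm_minus_commute)
    moreover obtain y y' where y: "inverses (1 - w *\<^sub>C b) y" "inverses (1 - (r * w) *\<^sub>C b) y'"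
      using inv[OF 1(1)] inv[OF 1(2)] by blast
    ultimately have "norm (y - y') \<le> 1 / 8"
      by (simp add: G_def elem_inv_eq)
    with y show ?case
      unfolding iter_square_0 by blast
  next
    case (Suc k)
    \<comment> \<open>The square roots u and -u of w lie on the circle, so the hypothesis applies to both.\<close>
    define u where "u = csqrt w"
    have u: "u * u = w" using power2_csqrt[of w] by (simp add: u_def power2_eq_square)
    have "(cmod u)\<^sup>2 = 1"
      using Suc.prems u by (metis norm_mult power2_eq_square)
    then have nu: "cmod u = 1" "cmod (- u) = 1"
      by (simp_all add: power2_eq_1_iff)
        (metis norm_ge_zero zero_le_one neg_0_le_iff_le not_one_le_zero)+
    obtain y y' where y: "inverses (1 - u *\<^sub>C iter_square k b) y"
      "inverses (1 - (iter_square k r * u) *\<^sub>C iter_square k b) y'" "norm (y - y') \<le> 1 / 8"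
      using Suc.IH[OF nu(1)] by blast
    obtain z z' where z: "inverses (1 + u *\<^sub>C iter_square k b) z"
      "inverses (1 + (iter_square k r * u) *\<^sub>C iter_square k b) z'" "norm (z - z') \<le> 1 / 8"
      using Suc.IH[OF nu(2)] by auto
    have e: "(c *\<^sub>C iter_square k b) * (c *\<^sub>C iter_square k b) = (c * c) *\<^sub>C iter_square (Suc k) b" for c
      by (simp add: mult_scaleC_left mult_scaleC_right scaleC_scaleC iter_square_Suc)
    have e': "iter_square k r * u * (iter_square k r * u) = iter_square (Suc k) r * w"
      by (simp add: iter_square_Suc u[symmetric])
    have "(1 / 2) *\<^sub>R (y + z) - (1 / 2) *\<^sub>R (y' + z') = (1 / 2) *\<^sub>R ((y - y') + (z - z'))"
      by (simp add: algebra_simps)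
    then have "norm ((1 / 2) *\<^sub>R (y + z) - (1 / 2) *\<^sub>R (y' + z')) = norm ((y - y') + (z - z')) / 2"
      by simp
    also have "\<dots> \<le> 1 / 8"
      using norm_triangle_ineq[of "y - y'" "z - z'"] y(3) z(3) by linarith
    finally show ?case
      using inverses_one_minus_square[OF y(1) z(1)] inverses_one_minus_square[OF y(2) z(2)]
      unfolding e e' u by blast
  qed
  have "(\<lambda>n. r ^ n) \<longlonglongrightarrow> 0"
    using r by (intro LIMSEQ_power_zero) auto
  then have "\<forall>\<^sub>F n in sequentially. r ^ n < 1 / 9"
    by (rule order_tendstoD) simp
  then obtain n where n: "\<And>m. m \<ge> n \<Longrightarrow> r ^ m < 1 / 9"
    by (auto simp: eventually_sequentially)
  have rn: "iter_square n r < 1 / 9"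
    unfolding iter_square_def by (rule n) (simp add: less_imp_le)
  define c where "c = iter_square n b"
  have nc: "norm c = 1" using norm_sqpow[OF sa] nb by (simp add: c_def)
  obtain y y' where y: "inverses (1 - c) y" "inverses (1 - of_real (iter_square n r) *\<^sub>C c) y'"
    "norm (y - y') \<le> 1 / 8"
    using *[of 1 n] unfolding c_def[symmetric] by (auto simp: scaleC_one)
  define x where "x = of_real (iter_square n r) *\<^sub>C c"
  have nx: "norm x \<le> 1 / 9"
    using rn rk[of n] nc by (simp add: x_def norm_scaleC)
  \<comment> \<open>As x is small, its resolvent y' is close to 1.\<close>
  have "y' - 1 = x * y'" using y(2) by (simp add: inverses_def x_def algebra_simps)
  then have "norm (y' - 1) \<le> 1 / 9 * norm y'"
    by (metis nx mult_right_mono norm_ge_zero norm_mult_ineq order_trans)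
  moreover have "norm y' \<le> 1 + norm (y' - 1)"
    using norm_triangle_ineq[of 1 "y' - 1"] by simp
  ultimately have "norm (y' - 1) \<le> 1 / 8" by simp
  then have y1: "norm (y - 1) \<le> 1 / 4"
    using norm_triangle_ineq[of "y - y'" "y' - 1"] y(3) by simp
  have "c = (1 - c) * (y - 1)"
    using y(1) by (simp add: inverses_def algebra_simps)
  then have "norm c \<le> norm (1 - c) * (1 / 4)"
    by (metis y1 mult_left_mono norm_ge_zero norm_mult_ineq order_trans)
  also have "\<dots> \<le> 2 * (1 / 4)"
    using norm_triangle_ineq4[of 1 c] nc by simp
  finally show False using nc by simp
qed

text \<open>
  After scaling \<open>a\<close> to norm \<open>1\<close>, the singular point in the unit disc provided by the preceding
  lemma cannot be interior, because the Neumann series converges there.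
\<close>

theorem spectral_radius_attained:
  fixes a :: "'a::cstar_algebra"
  assumes "star a = a"
  shows "\<exists>z\<in>spectrum a. cmod z = norm a"
proof (cases "a = 0")
  case True
  then show ?thesis
    by (intro bexI[of _ 0]) (auto simp: spectrum_def)
next
  case False
  define \<rho> where "\<rho> = norm a"
  have \<rho>: "\<rho> > 0" using False by (simp add: \<rho>_def)
  show ?thesis
  proof (rule ccontr)
    assume neg: "\<not> ?thesis"
    define b where "b = (1 / \<rho>) *\<^sub>R a"
    have sb: "star b = b" using assms by (simp add: b_def star_scaleR)
    have nb: "norm b = 1" using \<rho> by (simp add: b_def) (simp add: \<rho>_def)
    obtain w where w: "cmod w \<le> 1" "\<nexists>y. inverses (1 - w *\<^sub>C b) y"
      using unit_disc_resolvent_singular[OF sb nb] by blast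
    have "cmod w = 1"
    proof (rule ccontr)
      assume "cmod w \<noteq> 1"
      then have "norm (w *\<^sub>C b) < 1" using w(1) nb by (simp add: norm_scaleC)
      with w(2) show False using inverses_one_minus_ex by blast
    qed
    then have "w \<noteq> 0" by auto
    have e: "1 - w *\<^sub>C b = (- w / \<rho>) *\<^sub>C (a - (\<rho> / w) *\<^sub>C 1)"
      using \<open>w \<noteq> 0\<close> \<rho>
      by (simp add: b_def scaleR_scaleC scaleC.scale_right_diff_distrib scaleC_scaleC scaleC_one)
    have "\<rho> / w \<in> spectrum a"
      using scaleC_spectrum_iff[OF e] w(2) \<open>w \<noteq> 0\<close> \<rho> by simp
    moreover have "cmod (\<rho> / w) = norm a"
      using \<open>cmod w = 1\<close> \<rho> by (simp add: norm_divide \<rho>_def)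
    ultimately show False using neg by blast
  qed
qed

text \<open>
  If \<open>z\<close> is in the spectrum of \<open>a\<close>, then \<open>z + \<i>\<tau>\<close> is in that of \<open>a + \<i>\<tau>\<close>, whose norm squared
  is at most \<open>\<parallel>a\<parallel>\<^sup>2 + \<tau>\<^sup>2\<close> by the C*-identity. But \<open>(Im z + \<tau>)\<^sup>2\<close> exceeds \<open>\<tau>\<^sup>2\<close> by a quantity
  that is unbounded in \<open>\<tau>\<close> unless \<open>Im z = 0\<close>.
\<close>

lemma spectrum_real:
  fixes a :: "'a::cstar_algebra"
  assumes sa: "star a = a" and z: "z \<in> spectrum a"
  shows "Im z = 0"
proof (rule ccontr)
  assume "Im z \<noteq> 0"
  define \<beta> where "\<beta> = Im z"
  \<comment> \<open>Chosen such that twice its product with the imaginary part exceeds the squared norm of a.\<close>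
  define \<tau> where "\<tau> = ((norm a)\<^sup>2 + 1) / (2 * \<beta>)"
  define c where "c = a + (\<i> * \<tau>) *\<^sub>C 1"
  have ii: "\<i> * of_real \<tau> * (\<i> * of_real \<tau>) = - (complex_of_real \<tau> * of_real \<tau>)"
    by (simp add: complex_eq_iff)
  have "z + \<i> * \<tau> \<in> spectrum c"
    using z by (simp add: in_spectrum_iff c_def scaleC_add_left)
  then have "(cmod (z + \<i> * \<tau>))\<^sup>2 \<le> (norm c)\<^sup>2"
    using spectrum_norm_bound power_mono norm_ge_zero by blast
  also have "(norm c)\<^sup>2 = norm (star c * c)"
    by (simp add: cstar_identity)
  also have "star c * c = a * a + (\<tau>\<^sup>2) *\<^sub>R 1"
    by (simp add: c_def star_add star_scaleC sa distrib_left distrib_right mult_scaleC_left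
        left_diff_distrib right_diff_distrib mult_scaleC_right star_diff star_scaleC scaleC_scaleC
        scaleR_scaleC power2_eq_square ii scaleC.scale_right_diff_distrib)
  also have "norm \<dots> \<le> (norm a)\<^sup>2 + \<tau>\<^sup>2"
    using norm_triangle_ineq[of "a * a" "\<tau>\<^sup>2 *\<^sub>R 1"] norm_mult_ineq[of a a]
    by (simp add: power2_eq_square)
  finally have "(Re z)\<^sup>2 + (\<beta> + \<tau>)\<^sup>2 \<le> (norm a)\<^sup>2 + \<tau>\<^sup>2"
    by (simp add: cmod_power2 \<beta>_def)
  then have "2 * \<beta> * \<tau> \<le> (norm a)\<^sup>2"
    using zero_le_power2[of "Re z"] zero_le_power2[of \<beta>] unfolding power2_sum by linarith
  moreover have "2 * \<beta> * \<tau> = (norm a)\<^sup>2 + 1"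
    using \<open>Im z \<noteq> 0\<close> by (simp add: \<tau>_def \<beta>_def)
  ultimately show False by simp
qed

section \<open>Positive elements\<close>

lemma spectrum_scalar_minus:
  fixes a :: "'a::cstar_algebra"
  assumes "z \<in> spectrum (t *\<^sub>R 1 - a)"
  shows "of_real t - z \<in> spectrum a"
proof -
  have e: "t *\<^sub>R 1 - a - z *\<^sub>C 1 = (- 1) *\<^sub>C (a - (of_real t - z) *\<^sub>C 1)"
    by (simp add: scaleR_scaleC scaleC.scale_left_diff_distrib scaleC.scale_minus_left scaleC_one)
  have "\<nexists>b. inverses (t *\<^sub>R 1 - a - z *\<^sub>C 1) b"
    using assms unfolding in_spectrum_iff .
  then show ?thesis
    using scaleC_spectrum_iff[OF e] by simp
qed

lemma star_scalar_minus: "star a = a \<Longrightarrow> star (t *\<^sub>R 1 - a) = t *\<^sub>R 1 - (a::'a::cstar_algebra)"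
  by (simp add: star_diff star_scaleR)

lemma positive_star: "positive a \<Longrightarrow> star a = a"
  by (simp add: positive_def)

text \<open>
  Together with \<open>positiveI\<close>, this describes positivity of self-adjoint elements by the norm. A spectral point
  \<open>z\<close> of \<open>t - a\<close> realising its norm has the form \<open>t - y\<close> with \<open>y\<close> in the spectrum of \<open>a\<close>, that
  is, with \<open>0 \<le> y \<le> t\<close>.
\<close>

lemma positive_norm_le:
  assumes "positive a" "norm a \<le> t"
  shows "norm (t *\<^sub>R 1 - a) \<le> t"
proof -
  obtain z where z: "z \<in> spectrum (t *\<^sub>R 1 - a)" "cmod z = norm (t *\<^sub>R 1 - a)"
    using spectral_radius_attained[of "t *\<^sub>R 1 - a"] star_scalar_minus[of a t] assms
    by (auto simp: positive_def)
  let ?x = "of_real t - z"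
  have x: "?x \<in> spectrum a" using z(1) by (rule spectrum_scalar_minus)
  then have "?x \<in> \<real>\<^sub>\<ge>\<^sub>0" "cmod ?x \<le> t"
    using assms spectrum_norm_bound[OF x] by (auto simp: positive_def)
  then obtain y where y: "?x = of_real y" "0 \<le> y" "y \<le> t"
    by (auto elim!: nonneg_Reals_cases)
  have "z = of_real t - ?x" by simp
  also have "\<dots> = of_real (t - y)" unfolding y(1) by simp
  finally show ?thesis using z(2) y by (simp only: norm_of_real)
qed

lemma positiveI:
  fixes a :: "'a::cstar_algebra"
  assumes "star a = a" "norm (t *\<^sub>R 1 - a) \<le> t"
  shows "positive a"
  unfolding positive_def
proof (intro conjI subsetI)
  fix z assume z: "z \<in> spectrum a"
  have "a = t *\<^sub>R 1 - (t *\<^sub>R 1 - a)" by simp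
  with z have "of_real t - z \<in> spectrum (t *\<^sub>R 1 - a)"
    by (metis spectrum_scalar_minus)
  then have "cmod (of_real t - z) \<le> t"
    using spectrum_norm_bound assms(2) order_trans by blast
  then have "0 \<le> Re z"
    using complex_Re_le_cmod[of "of_real t - z"] by simp
  then show "z \<in> \<real>\<^sub>\<ge>\<^sub>0"
    using spectrum_real[OF assms(1) z] by (simp add: complex_nonneg_Reals_iff)
qed (rule assms(1))

lemma positive_add:
  assumes "positive a" "positive b"
  shows "positive (a + b)"
proof (rule positiveI)
  show "star (a + b) = a + b" using assms by (simp add: positive_def star_add)
  have "norm ((norm a *\<^sub>R 1 - a) + (norm b *\<^sub>R 1 - b)) \<le> norm a + norm b"
    using positive_norm_le[OF assms(1) order_refl] positive_norm_le[OF assms(2) order_refl]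
      norm_triangle_ineq[of "norm a *\<^sub>R 1 - a" "norm b *\<^sub>R 1 - b"] by linarith
  then show "norm ((norm a + norm b) *\<^sub>R 1 - (a + b)) \<le> norm a + norm b"
    by (simp add: scaleR_add_left algebra_simps)
qed

lemma positive_0: "positive 0"
  by (rule positiveI[where t = 0]) auto

lemma positive_sum: "(\<And>i. i \<in> I \<Longrightarrow> positive (f i)) \<Longrightarrow> positive (\<Sum>i\<in>I. f i)"
  by (induction I rule: infinite_finite_induct) (auto simp: positive_0 positive_add)

lemma positive_scaleR:
  assumes "positive a" "0 \<le> r"
  shows "positive (r *\<^sub>R a)"
proof (rule positiveI)
  show "star (r *\<^sub>R a) = r *\<^sub>R a" using assms by (simp add: positive_def star_scaleR)
  have "norm (r *\<^sub>R (norm a *\<^sub>R 1 - a)) \<le> r * norm a"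
    using positive_norm_le[OF assms(1) order_refl] assms(2) by (simp add: mult_left_mono)
  then show "norm ((r * norm a) *\<^sub>R 1 - r *\<^sub>R a) \<le> r * norm a"
    by (simp add: algebra_simps)
qed

lemma positive_scalar_minus:
  assumes "positive b" "norm b \<le> r"
  shows "positive (r *\<^sub>R 1 - b)"
  by (rule positiveI[where t = r]) (use assms in \<open>auto simp: star_scalar_minus positive_def\<close>)

text \<open>
  The spectral value of \<open>a\<close> whose modulus is the norm is non-negative, and positivity of
  \<open>r - a\<close> keeps it below \<open>r\<close>.
\<close>

lemma norm_le_of_positive_diff:
  fixes a :: "'a::cstar_algebra"
  assumes a: "positive a" and d: "positive (r *\<^sub>R 1 - a)"
  shows "norm a \<le> r"
proof -
  obtain z where z: "z \<in> spectrum a" "cmod z = norm a"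
    using spectral_radius_attained a by (auto simp: positive_def)
  have "a = r *\<^sub>R 1 - (r *\<^sub>R 1 - a)" by simp
  with z have "of_real r - z \<in> spectrum (r *\<^sub>R 1 - a)"
    by (metis spectrum_scalar_minus)
  with d have "of_real r - z \<in> \<real>\<^sub>\<ge>\<^sub>0" by (auto simp: positive_def)
  moreover have "z \<in> \<real>\<^sub>\<ge>\<^sub>0" using z a by (auto simp: positive_def)
  ultimately show ?thesis using z(2)
    by (auto simp: complex_nonneg_Reals_iff cmod_eq_Re)
qed

text \<open>
  A negative number \<open>- s\<^sup>2\<close> is not a spectral value, because \<open>h\<^sup>2 + s\<^sup>2 = (h - \<i>s) (h + \<i>s)\<close>
  and the spectrum of \<open>h\<close> is real.
\<close>

lemma positive_square:
  fixes h :: "'a::cstar_algebra"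
  assumes "star h = h"
  shows "positive (h * h)"
proof -
  have sa: "star (h * h) = h * h" by (simp add: star_mult assms)
  have "z \<in> \<real>\<^sub>\<ge>\<^sub>0" if z: "z \<in> spectrum (h * h)" for z
  proof (rule ccontr)
    assume n: "z \<notin> \<real>\<^sub>\<ge>\<^sub>0"
    have im: "Im z = 0" using spectrum_real[OF sa z] .
    define s where "s = sqrt (- Re z)"
    have s: "Re z = - (s * s)" "s \<noteq> 0"
      using n im by (auto simp: s_def complex_nonneg_Reals_iff)
    let ?w = "\<i> * of_real s"
    have zw: "z = ?w * ?w" using s im by (simp add: complex_eq_iff)
    have e: "h * h - z *\<^sub>C 1 = (h - ?w *\<^sub>C 1) * (h - (- ?w) *\<^sub>C 1)"
      unfolding zw
      by (simp add: left_diff_distrib right_diff_distrib mult_scaleC_left mult_scaleC_right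
          scaleC.scale_right_diff_distrib scaleC_scaleC scaleC.scale_minus_left distrib_left
          distrib_right scaleC_add_right)
    have nsp: "?w \<notin> spectrum h" "- ?w \<notin> spectrum h"
      using spectrum_real[OF assms, of ?w] spectrum_real[OF assms, of "- ?w"] s by auto
    then obtain p q where "inverses (h - ?w *\<^sub>C 1) p" "inverses (h - (- ?w) *\<^sub>C 1) q"
      unfolding in_spectrum_iff by blast
    then have "inverses (h * h - z *\<^sub>C 1) (q * p)"
      unfolding e inverses_def by (metis mult.assoc mult.left_neutral)
    with z show False unfolding in_spectrum_iff by blast
  qed
  with sa show ?thesis by (auto simp: positive_def)
qed

lemma convergent_of_dominated_increments:
  fixes y :: "nat \<Rightarrow> 'a::banach"
  assumes t: "convergent (t :: nat \<Rightarrow> real)"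
    and d: "\<And>n. norm (y (Suc n) - y n) \<le> t (Suc n) - t n"
  shows "convergent y"
proof -
  have "summable (\<lambda>n. t (Suc n) - t n)"
    using t telescope_summable unfolding convergent_def by blast
  then have "summable (\<lambda>n. y (Suc n) - y n)"
    by (rule summable_comparison_test'[where N = 0]) (rule d)
  then have "convergent (\<lambda>n. \<Sum>k<n. y (Suc k) - y k)"
    by (simp add: summable_iff_convergent)
  then have "convergent (\<lambda>n. y n - y 0)"
    by (simp add: sum_lessThan_telescope)
  then show ?thesis
    using convergent_diff_const_right_iff by blast
qed

text \<open>
  With \<open>x = 1 - y\<close>, the equation \<open>x\<^sup>2 = 1 - c\<close> becomes the fixed point equation
  \<open>y = (c + y\<^sup>2) / 2\<close>. Its iteration from \<open>0\<close> is dominated, increment by increment, by the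
  scalar iteration for \<open>c = 1\<close>, which increases and is bounded by \<open>1\<close>; hence it converges even
  when the norm of \<open>c\<close> is \<open>1\<close>. All iterates are polynomials in \<open>c\<close>, so the limit commutes with
  everything that commutes with \<open>c\<close>.
\<close>

lemma sqrt_one_minus:
  fixes c :: "'a::cstar_algebra"
  assumes c: "star c = c" "norm c \<le> 1"
  shows "\<exists>y. star y = y \<and> norm y \<le> 1 \<and> (1 - y) * (1 - y) = 1 - c \<and> (\<forall>w. w * c = c * w \<longrightarrow> w * y = y * w)"
proof -
  define y where "y = rec_nat 0 (\<lambda>n u. (1 / 2) *\<^sub>R (c + u * u))"
  define t where "t = rec_nat (0::real) (\<lambda>n u. (1 + u * u) / 2)"
  have y: "y 0 = 0" "y (Suc n) = (1 / 2) *\<^sub>R (c + y n * y n)" for n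
    by (simp_all add: y_def)
  have t: "t 0 = 0" "t (Suc n) = (1 + t n * t n) / 2" for n
    by (simp_all add: t_def)
  have t01: "0 \<le> t n \<and> t n \<le> 1" for n
  proof (induction n)
    case (Suc n)
    then have "t n * t n \<le> 1" "0 \<le> t n * t n" by (auto intro: mult_le_one)
    then show ?case by (simp add: t)
  qed (simp add: t)
  have "t n \<le> t (Suc n)" for n
    using sum_squares_ge_zero[of "1 - t n" 0] by (simp add: t algebra_simps)
  then have "convergent t"
    using t01 by (intro Bseq_mono_convergent BseqI'[where K = 1]) (auto intro: lift_Suc_mono_le)
  have comm: "w * c = c * w \<Longrightarrow> w * y n = y n * w" for n w
  proof (induction n)
    case (Suc n)
    then have "w * (y n * y n) = (y n * y n) * w"
      by (metis mult.assoc)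
    with Suc show ?case by (simp add: y distrib_left distrib_right)
  qed (simp add: y)
  then have cy: "c * y n = y n * c" for n by simp
  have yy: "y m * y n = y n * y m" for m n
    by (rule comm) (rule cy[symmetric])
  have ny: "norm (y n) \<le> t n" for n
  proof (induction n)
    case (Suc n)
    have "norm (y n * y n) \<le> t n * t n"
      using Suc t01[of n] norm_mult_ineq[of "y n" "y n"]
      by (meson mult_mono norm_ge_zero order_trans)
    then show ?case
      using norm_triangle_ineq[of c "y n * y n"] c(2) by (simp add: y t)
  qed (simp add: y t)
  have d: "norm (y (Suc n) - y n) \<le> t (Suc n) - t n" for n
  proof (induction n)
    case 0
    then show ?case using c(2) by (simp add: y t)
  next
    case (Suc n)
    have "y (Suc (Suc n)) - y (Suc n) = (1 / 2) *\<^sub>R (y (Suc n) * y (Suc n) - y n * y n)"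
      by (simp add: y(2)[of "Suc n"] y(2)[of n] algebra_simps)
    also have "y (Suc n) * y (Suc n) - y n * y n = (y (Suc n) - y n) * (y (Suc n) + y n)"
      using yy[of n "Suc n"] by (simp add: algebra_simps)
    finally have "norm (y (Suc (Suc n)) - y (Suc n))
        = norm ((y (Suc n) - y n) * (y (Suc n) + y n)) / 2"
      by simp
    also have "\<dots> \<le> (t (Suc n) - t n) * (t (Suc n) + t n) / 2"
    proof (rule divide_right_mono)
      have "norm (y (Suc n) + y n) \<le> t (Suc n) + t n"
        using norm_triangle_ineq[of "y (Suc n)" "y n"] ny[of n] ny[of "Suc n"] by linarith
      moreover have "0 \<le> t (Suc n) - t n"
        using Suc norm_ge_zero order_trans by blast
      ultimately have "norm (y (Suc n) - y n) * norm (y (Suc n) + y n)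
          \<le> (t (Suc n) - t n) * (t (Suc n) + t n)"
        using Suc by (intro mult_mono) auto
      then show "norm ((y (Suc n) - y n) * (y (Suc n) + y n))
          \<le> (t (Suc n) - t n) * (t (Suc n) + t n)"
        using norm_mult_ineq order_trans by blast
    qed simp
    also have "\<dots> = t (Suc (Suc n)) - t (Suc n)"
      by (simp add: t(2)[of "Suc n"] t(2)[of n] algebra_simps) (simp add: field_simps)
    finally show ?case .
  qed
  obtain l where l: "y \<longlonglongrightarrow> l"
    using convergent_of_dominated_increments[OF \<open>convergent t\<close> d] by (auto simp: convergent_def)
  have "star (y n) = y n" for n
    by (induction n) (simp_all add: y star_scaleR star_add star_mult c)
  then have 1: "star l = l"
    using bounded_linear.tendsto[OF bounded_linear_star l] l LIMSEQ_unique by fastforce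
  have 2: "norm l \<le> 1"
    by (rule LIMSEQ_le_const2[OF tendsto_norm[OF l]]) (use ny t01 order_trans in blast)
  have "(\<lambda>n. y (Suc n)) \<longlonglongrightarrow> l" using l by (rule LIMSEQ_Suc)
  moreover have "(\<lambda>n. (1 / 2) *\<^sub>R (c + y n * y n)) \<longlonglongrightarrow> (1 / 2) *\<^sub>R (c + l * l)"
    by (intro tendsto_intros l)
  ultimately have "l = (1 / 2) *\<^sub>R (c + l * l)"
    unfolding y(2) using LIMSEQ_unique by blast
  then have "2 *\<^sub>R l = c + l * l"
    by (metis scaleR_one scaleR_scaleR nonzero_mult_div_cancel_left
        times_divide_eq_right mult.right_neutral zero_neq_numeral)
  then have 3: "(1 - l) * (1 - l) = 1 - c"
    by (simp add: algebra_simps scaleR_2)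
  have 4: "w * l = l * w" if "w * c = c * w" for w
  proof (rule LIMSEQ_unique)
    show "(\<lambda>n. w * y n) \<longlonglongrightarrow> w * l" by (intro tendsto_intros l)
    have "(\<lambda>n. y n * w) \<longlonglongrightarrow> l * w" by (intro tendsto_intros l)
    then show "(\<lambda>n. w * y n) \<longlonglongrightarrow> l * w" using comm[OF that] by simp
  qed
  show ?thesis using 1 2 3 4 by blast
qed

theorem positive_sqrt:
  fixes a :: "'a::cstar_algebra"
  assumes a: "positive a"
  obtains x where "positive x" "x * x = a" "\<And>w. w * a = a * w \<Longrightarrow> w * x = x * w"
proof (cases "a = 0")
  case True
  then show ?thesis using that[of 0] positive_0 by simp
next
  case False
  define t where "t = norm a"
  have t: "t > 0" using False by (simp add: t_def)
  define c where "c = 1 - (1 / t) *\<^sub>R a"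
  have c: "c = (1 / t) *\<^sub>R (t *\<^sub>R 1 - a)" using t by (simp add: c_def algebra_simps)
  have "norm c \<le> 1"
    unfolding c using t positive_norm_le[OF a, of t] by (simp add: t_def)
  moreover have "star c = c" using a by (simp add: c_def star_diff star_scaleR positive_star)
  ultimately obtain y where y: "star y = y" "norm y \<le> 1" "(1 - y) * (1 - y) = 1 - c"
    "\<And>w. w * c = c * w \<Longrightarrow> w * y = y * w"
    using sqrt_one_minus[of c] by metis
  define x where "x = sqrt t *\<^sub>R (1 - y)"
  have "positive (1 - y)"
    by (rule positiveI[where t = 1]) (use y in \<open>simp_all add: star_diff\<close>)
  then have 1: "positive x" unfolding x_def using t by (intro positive_scaleR) auto
  have "x * x = t *\<^sub>R ((1 - y) * (1 - y))"
    using t by (simp add: x_def)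
  also have "\<dots> = a" unfolding y(3) c_def using t by simp
  finally have 2: "x * x = a" .
  have "w * x = x * w" if "w * a = a * w" for w
  proof -
    have "w * c = c * w" using that by (simp add: c_def algebra_simps)
    then have "w * y = y * w" by (rule y(4))
    then show ?thesis by (simp add: x_def algebra_simps)
  qed
  with 1 2 that show ?thesis by blast
qed

lemma positive_antisym:
  fixes a :: "'a::cstar_algebra"
  assumes "positive a" "positive (- a)"
  shows "a = 0"
  using norm_le_of_positive_diff[of a 0] assms by simp

text \<open>
  Twice this element is \<open>p\<^sup>2 + q\<^sup>2\<close> for the self-adjoint elements \<open>p = y + y\<^sup>*\<close> and
  \<open>q = \<i> (y\<^sup>* - y)\<close>.
\<close>

lemma positive_star_mult_add_mult_star:
  fixes y :: "'a::cstar_algebra"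
  shows "positive (star y * y + y * star y)"
proof -
  define p where "p = y + star y"
  define q where "q = \<i> *\<^sub>C (star y - y)"
  have "positive (p * p)" "positive (q * q)"
    by (rule positive_square; simp add: p_def q_def star_add star_star star_scaleC star_diff
        scaleC.scale_right_diff_distrib)+
  then have "positive ((1 / 2) *\<^sub>R (p * p + q * q))"
    by (intro positive_scaleR positive_add) auto
  also have "p * p + q * q = 2 *\<^sub>R (star y * y + y * star y)"
    by (simp add: p_def q_def algebra_simps mult_scaleC_left mult_scaleC_right scaleC_scaleC
      scaleR_2 scaleC.scale_right_diff_distrib scaleC_one)
  finally show ?thesis by simp
qed

text \<open>
  \<open>y\<^sup>* y\<close> and \<open>y y\<^sup>*\<close> have the same non-zero spectrum.
\<close>

lemma positive_uminus_swap:
  fixes y :: "'a::cstar_algebra"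
  assumes "positive (- (star y * y))"
  shows "positive (- (y * star y))"
  unfolding positive_def
proof (intro conjI subsetI)
  show "star (- (y * star y)) = - (y * star y)" by (simp add: star_minus star_mult star_star)
  fix z assume z: "z \<in> spectrum (- (y * star y))"
  show "z \<in> \<real>\<^sub>\<ge>\<^sub>0"
  proof (cases "z = 0")
    case False
    let ?y = "(- inverse z) *\<^sub>C y"
    have e: "1 - ?y * star y = (- inverse z) *\<^sub>C (- (y * star y) - z *\<^sub>C 1)"
      "1 - star y * ?y = (- inverse z) *\<^sub>C (- (star y * y) - z *\<^sub>C 1)"
      using False by (simp_all add: mult_scaleC_left mult_scaleC_right scaleC.scale_right_diff_distrib
          scaleC_scaleC scaleC_one)
    have "\<nexists>b. inverses (1 - ?y * star y) b"
      using scaleC_spectrum_iff[OF e(1)] z False by simp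
    then have "\<nexists>b. inverses (1 - star y * ?y) b"
      using inverses_one_minus_swap by blast
    then have "z \<in> spectrum (- (star y * y))"
      using scaleC_spectrum_iff[OF e(2)] False by simp
    then show ?thesis using assms by (auto simp: positive_def)
  qed simp
qed

text \<open>
  Put \<open>a = x\<^sup>* x\<close>. The square root \<open>m\<close> of \<open>a\<^sup>2\<close> plays the part of \<open>|a|\<close>, and the claim is that
  \<open>v = m - a\<close>, twice the negative part of \<open>a\<close>, vanishes. As \<open>a v = - m v\<close>, the element
  \<open>y = x v\<close> satisfies \<open>y\<^sup>* y = - v m v = - h\<^sup>2\<close> with \<open>h = m\<^bsup>1/2\<^esup> v\<close> self-adjoint, so \<open>- y\<^sup>* y\<close>
  is positive. Then \<open>- y y\<^sup>*\<close> is positive too, and adding it to the positive element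
  \<open>y\<^sup>* y + y y\<^sup>*\<close> shows that \<open>y\<^sup>* y\<close> is positive as well. Hence \<open>h = 0\<close>, so \<open>m v = 0 = a v\<close>,
  and \<open>v\<^sup>2 = 0\<close>.
\<close>

theorem positive_star_mult:
  fixes x :: "'a::cstar_algebra"
  shows "positive (star x * x)"
proof -
  define a where "a = star x * x"
  have sa: "star a = a" by (simp add: a_def star_mult star_star)
  obtain m where m: "positive m" "m * m = a * a" "\<And>w. w * (a * a) = (a * a) * w \<Longrightarrow> w * m = m * w"
    using positive_sqrt[OF positive_square[OF sa]] by metis
  have am: "a * m = m * a" using m(3)[of a] by (simp add: mult.assoc)
  obtain w where w: "positive w" "w * w = m" "\<And>u. u * m = m * u \<Longrightarrow> u * w = w * u"
    using positive_sqrt[OF m(1)] by metis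
  have aw: "a * w = w * a" using w(3) am by blast
  have mw: "m * w = w * m" using w(2) by (metis mult.assoc)
  define v where "v = m - a"
  have sv: "star v = v" by (simp add: v_def star_diff sa positive_star m)
  have vw: "v * w = w * v" by (simp add: v_def algebra_simps aw mw)
  have av: "a * v = - (m * v)"
    by (simp add: v_def algebra_simps m(2) am)
  define h where "h = w * v"
  have sh: "star h = h"
    by (simp add: h_def star_mult sv positive_star[OF w(1)] vw)
  define y where "y = x * v"
  have "star y * y = v * (a * v)"
    by (simp add: y_def star_mult sv a_def mult.assoc)
  also have "\<dots> = - (v * (m * v))" by (simp add: av)
  also have "v * (m * v) = h * h"
    unfolding h_def w(2)[symmetric] using vw by (metis mult.assoc)
  finally have yy: "star y * y = - (h * h)" .
  have "positive (- (star y * y))" using positive_square[OF sh] yy by simp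
  moreover from this have "positive (star y * y + y * star y + - (y * star y))"
    by (intro positive_add positive_star_mult_add_mult_star positive_uminus_swap)
  ultimately have "star y * y = 0"
    by (intro positive_antisym) auto
  then have "h * h = 0" using yy by simp
  then have "star h * h = 0" using sh by simp
  then have "h = 0" by (simp add: cstar_eq_0_iff)
  then have "m * v = 0" unfolding w(2)[symmetric] h_def by (simp add: mult.assoc)
  with av have "v * v = 0" unfolding v_def by (simp add: left_diff_distrib)
  then have "v = 0" using sv cstar_eq_0_iff[of v] by simp
  then show ?thesis using m(1) by (simp add: v_def a_def)
qed

lemma positive_conj:
  fixes c :: "'a::cstar_algebra"
  assumes "positive c"
  shows "positive (star x * c * x)"
proof -
  obtain d where d: "positive d" "d * d = c" using positive_sqrt[OF assms] by metis
  have "star x * c * x = star (d * x) * (d * x)"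
    using d positive_star[OF d(1)] by (simp add: star_mult mult.assoc flip: d(2))
  then show ?thesis by (simp add: positive_star_mult)
qed

section \<open>The Hilbert module of columns\<close>

definition vinner :: "'a::cstar_algebra^'n \<Rightarrow> 'a^'n \<Rightarrow> 'a"
  where "vinner x y = (\<Sum>i\<in>UNIV. star (x $ i) * y $ i)"

lemma vinner_add:
  "vinner (x + y) z = vinner x z + vinner y z"
  "vinner x (y + z) = vinner x y + vinner x z"
  by (simp_all add: vinner_def star_add distrib_left distrib_right sum.distrib)

lemma vinner_diff:
  "vinner (x - y) z = vinner x z - vinner y z"
  "vinner x (y - z) = vinner x y - vinner x z"
  by (simp_all add: vinner_def star_diff left_diff_distrib right_diff_distrib sum_subtractf)

lemma vinner_scaleR: "vinner (r *\<^sub>R x) y = r *\<^sub>R vinner x y" "vinner x (r *\<^sub>R y) = r *\<^sub>R vinner x y"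
  by (simp_all add: vinner_def star_scaleR scaleR_sum_right)

lemma vinner_self_positive: "positive (vinner x x)"
  unfolding vinner_def by (intro positive_sum positive_star_mult)

lemma vinner_adjoint:
  fixes A :: "'a::cstar_algebra^'n^'n"
  shows "vinner x (A *v y) = vinner (mat_star A *v x) y"
proof -
  have "vinner x (A *v y) = (\<Sum>i\<in>UNIV. \<Sum>j\<in>UNIV. star (x $ i) * (A $ i $ j * y $ j))"
    by (simp add: vinner_def matrix_vector_mult_def sum_distrib_left)
  also have "\<dots> = (\<Sum>j\<in>UNIV. \<Sum>i\<in>UNIV. star (x $ i) * (A $ i $ j * y $ j))"
    by (rule sum.swap)
  also have "\<dots> = vinner (mat_star A *v x) y"
    by (simp add: vinner_def matrix_vector_mult_def mat_star_def star_sum star_mult star_star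
        sum_distrib_right mult.assoc)
  finally show ?thesis .
qed

lemma mat_star_matrix_mult:
  "mat_star (A ** B) = mat_star B ** mat_star (A :: 'a::cstar_algebra^'n^'n)"
  by (simp add: mat_star_def matrix_matrix_mult_def star_sum star_mult vec_eq_iff)

lemma mat_star_mat_star [simp]: "mat_star (mat_star A) = A"
  by (simp add: mat_star_def star_star vec_eq_iff)

section \<open>The operator norm of a matrix\<close>

text \<open>
  The inequality \<open>\<langle>A x, A x\<rangle> \<le> t\<^sup>2 \<langle>x, x\<rangle>\<close> in the order of the C*-algebra, for all columns
  \<open>x\<close>. The bound \<open>t = 0\<close> is excluded because the triangle inequality divides by it; the
  infimum is the same.
\<close>

definition op_bound :: "'a::cstar_algebra^'n^'n \<Rightarrow> real \<Rightarrow> bool"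
  where "op_bound A t \<longleftrightarrow>
    0 < t \<and> (\<forall>x. positive (t\<^sup>2 *\<^sub>R vinner x x - vinner (A *v x) (A *v x)))"

definition mat_norm :: "'a::cstar_algebra^'n^'n \<Rightarrow> real"
  where "mat_norm A = Inf {t. op_bound A t}"

lemma op_bound_pos: "op_bound A t \<Longrightarrow> 0 < t"
  by (simp add: op_bound_def)

lemma op_bound_mult:
  assumes "op_bound A s" "op_bound B t"
  shows "op_bound (A ** B) (s * t)"
  unfolding op_bound_def
proof (intro conjI allI)
  show "0 < s * t" using assms by (simp add: op_bound_def)
  fix x
  let ?y = "B *v x"
  have "positive (s\<^sup>2 *\<^sub>R (t\<^sup>2 *\<^sub>R vinner x x - vinner ?y ?y)
      + (s\<^sup>2 *\<^sub>R vinner ?y ?y - vinner (A *v ?y) (A *v ?y)))"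
    using assms by (intro positive_add positive_scaleR) (auto simp: op_bound_def)
  then show "positive ((s * t)\<^sup>2 *\<^sub>R vinner x x - vinner (A ** B *v x) (A ** B *v x))"
    by (simp add: matrix_vector_mul_assoc power_mult_distrib algebra_simps)
qed

lemma scaleR_mult_2: "(c * 2) *\<^sub>R x = c *\<^sub>R x + c *\<^sub>R (x::'a::real_vector)"
  by (simp only: mult_2_right scaleR_add_left)

text \<open>
  The parallelogram-type identity
  \<open>\<langle>u + v, u + v\<rangle> + \<langle>w, w\<rangle> = (1 + t / s) \<langle>u, u\<rangle> + (1 + s / t) \<langle>v, v\<rangle>\<close> with
  \<open>w = (t u - s v) / \<surd>(s t)\<close> replaces the Cauchy-Schwarz inequality; in the proof it is
  multiplied by \<open>s t\<close>.
\<close>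

lemma op_bound_add:
  assumes "op_bound A s" "op_bound B t"
  shows "op_bound (A + B) (s + t)"
  unfolding op_bound_def
proof (intro conjI allI)
  have pos: "0 < s" "0 < t" using assms by (simp_all add: op_bound_def)
  then show "0 < s + t" by simp
  fix x
  define u where "u = A *v x"
  define v where "v = B *v x"
  define w where "w = t *\<^sub>R u - s *\<^sub>R v"
  have p: "positive (s\<^sup>2 *\<^sub>R vinner x x - vinner u u)" "positive (t\<^sup>2 *\<^sub>R vinner x x - vinner v v)"
    using assms unfolding op_bound_def u_def v_def by blast+
  have "positive ((1 / (s * t)) *\<^sub>R (((s + t) * t) *\<^sub>R (s\<^sup>2 *\<^sub>R vinner x x - vinner u u)
      + ((s + t) * s) *\<^sub>R (t\<^sup>2 *\<^sub>R vinner x x - vinner v v) + vinner w w))"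
    using pos by (intro positive_scaleR positive_add p vinner_self_positive) auto
  also have "((s + t) * t) *\<^sub>R (s\<^sup>2 *\<^sub>R vinner x x - vinner u u)
      + ((s + t) * s) *\<^sub>R (t\<^sup>2 *\<^sub>R vinner x x - vinner v v) + vinner w w
      = (s * t) *\<^sub>R ((s + t)\<^sup>2 *\<^sub>R vinner x x - vinner (u + v) (u + v))"
    by (simp add: w_def vinner_add vinner_diff vinner_scaleR algebra_simps power2_eq_square)
      (simp add: scaleR_mult_2[of "s * (s * (t * t))", unfolded mult.assoc])
  also have "(1 / (s * t)) *\<^sub>R \<dots> = (s + t)\<^sup>2 *\<^sub>R vinner x x - vinner (u + v) (u + v)"
    using pos by simp
  finally show "positive ((s + t)\<^sup>2 *\<^sub>R vinner x x - vinner ((A + B) *v x) ((A + B) *v x))"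
    by (simp add: u_def v_def matrix_vector_mult_add_rdistrib)
qed

text \<open>
  This is the substantial half of the C*-identity. With \<open>B = A\<^sup>* A\<close> it follows from
  \<open>2 u (u \<langle>x, x\<rangle> - \<langle>x, B x\<rangle>) = \<langle>u x - B x, u x - B x\<rangle> + (u\<^sup>2 \<langle>x, x\<rangle> - \<langle>B x, B x\<rangle>)\<close>.
\<close>

lemma op_bound_sqrt:
  assumes "op_bound (mat_star A ** A) u"
  shows "op_bound A (sqrt u)"
  unfolding op_bound_def
proof (intro conjI allI)
  have u: "0 < u" using assms by (simp add: op_bound_def)
  then show "0 < sqrt u" by simp
  fix x
  let ?y = "(mat_star A ** A) *v x"
  have e: "vinner x ?y = vinner (A *v x) (A *v x)" "vinner ?y x = vinner (A *v x) (A *v x)"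
    using vinner_adjoint[of x "mat_star A" "A *v x"] vinner_adjoint[of "A *v x" A x]
    by (simp_all add: matrix_vector_mul_assoc)
  have "positive ((1 / (2 * u)) *\<^sub>R (vinner (u *\<^sub>R x - ?y) (u *\<^sub>R x - ?y)
      + (u\<^sup>2 *\<^sub>R vinner x x - vinner ?y ?y)))"
    using assms u by (intro positive_scaleR positive_add vinner_self_positive) (auto simp: op_bound_def)
  also have "vinner (u *\<^sub>R x - ?y) (u *\<^sub>R x - ?y) + (u\<^sup>2 *\<^sub>R vinner x x - vinner ?y ?y)
    = (2 * u) *\<^sub>R (u *\<^sub>R vinner x x - vinner (A *v x) (A *v x))"
    by (simp add: vinner_diff vinner_scaleR e algebra_simps power2_eq_square)
      (simp add: scaleR_mult_2 scaleR_mult_2[of "u * u", unfolded mult.assoc])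
  finally show "positive ((sqrt u)\<^sup>2 *\<^sub>R vinner x x - vinner (A *v x) (A *v x))"
    using u by simp
qed

lemma vinner_axis: "vinner (axis j 1) (axis j 1) = (1::'a::cstar_algebra)"
  by (simp add: vinner_def axis_def if_distrib if_distribR cong: if_cong)

lemma matrix_vector_axis: "((A::'a::semiring_1^'n^'m) *v axis j 1) $ i = A $ i $ j"
  by (simp add: matrix_vector_mult_def axis_def if_distrib cong: if_cong)

text \<open>
  Apply the bound to the basis column \<open>e\<^sub>j\<close>, for which \<open>\<langle>A e\<^sub>j, A e\<^sub>j\<rangle>\<close> is the sum of
  \<open>a\<^bsub>k j\<^esub>\<^sup>* a\<^bsub>k j\<^esub>\<close> over \<open>k\<close>.
\<close>

lemma op_bound_entry:
  fixes A :: "'a::cstar_algebra^'n^'n"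
  assumes "op_bound A t"
  shows "norm (A $ i $ j) \<le> t"
proof -
  let ?f = "\<lambda>k. star (A $ k $ j) * A $ k $ j"
  have "positive (t\<^sup>2 *\<^sub>R 1 - (\<Sum>k\<in>UNIV. ?f k))"
    using assms unfolding op_bound_def
    by (metis (no_types, lifting) matrix_vector_axis sum.cong vinner_axis vinner_def)
  then have "positive (t\<^sup>2 *\<^sub>R 1 - (\<Sum>k\<in>UNIV. ?f k) + (\<Sum>k\<in>UNIV - {i}. ?f k))"
    by (intro positive_add positive_sum positive_star_mult)
  also have "t\<^sup>2 *\<^sub>R 1 - (\<Sum>k\<in>UNIV. ?f k) + (\<Sum>k\<in>UNIV - {i}. ?f k) = t\<^sup>2 *\<^sub>R 1 - ?f i"
    by (subst sum.remove[of _ i]) auto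
  finally have "norm (?f i) \<le> t\<^sup>2"
    by (intro norm_le_of_positive_diff positive_star_mult)
  then show ?thesis
    using op_bound_pos[OF assms] by (simp add: cstar_identity abs_le_square_iff[symmetric])
qed

definition mat_unit :: "'n \<Rightarrow> 'n \<Rightarrow> 'a::zero \<Rightarrow> 'a^'n^'n"
  where "mat_unit i j a = (\<chi> k l. if k = i \<and> l = j then a else 0)"

lemma op_bound_mat_unit:
  fixes a :: "'a::cstar_algebra" and i j :: "'n::finite"
  assumes "norm a \<le> t" "0 < t"
  shows "op_bound (mat_unit i j a) t"
  unfolding op_bound_def
proof (intro conjI allI)
  fix x :: "'a^'n"
  have "(mat_unit i j a *v x) $ k = (if k = i then a * x $ j else 0)" for k
  proof (cases "k = i")
    case True
    then show ?thesis
      by (simp add: mat_unit_def matrix_vector_mult_def if_distribR cong: if_cong)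
        (simp add: if_distrib if_distribR cong: if_cong)
  qed (simp add: mat_unit_def matrix_vector_mult_def)
  then have e: "mat_unit i j a *v x = (\<chi> k. if k = i then a * x $ j else 0)"
    by (simp add: vec_eq_iff)
  have 1: "vinner (mat_unit i j a *v x) (mat_unit i j a *v x) = star (x $ j) * (star a * a) * x $ j"
    unfolding e by (simp add: vinner_def if_distrib if_distribR star_mult mult.assoc cong: if_cong)
  have "norm (star a * a) \<le> t\<^sup>2"
    using assms by (simp add: cstar_identity power_mono)
  then have "positive (star (x $ j) * (t\<^sup>2 *\<^sub>R 1 - star a * a) * x $ j
      + t\<^sup>2 *\<^sub>R (\<Sum>k\<in>UNIV - {j}. star (x $ k) * x $ k))"
    by (intro positive_add positive_scaleR positive_sum positive_conj positive_star_mult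
        positive_scalar_minus) auto
  also have "star (x $ j) * (t\<^sup>2 *\<^sub>R 1 - star a * a) * x $ j
      + t\<^sup>2 *\<^sub>R (\<Sum>k\<in>UNIV - {j}. star (x $ k) * x $ k)
     = t\<^sup>2 *\<^sub>R vinner x x - star (x $ j) * (star a * a) * x $ j"
    unfolding vinner_def by (subst (2) sum.remove[of _ j]) (auto simp: algebra_simps)
  finally show "positive (t\<^sup>2 *\<^sub>R vinner x x - vinner (mat_unit i j a *v x) (mat_unit i j a *v x))"
    unfolding 1 .
qed (rule assms)

lemma sum_mat_unit: "(\<Sum>i\<in>UNIV. \<Sum>j\<in>UNIV. mat_unit i j (A $ i $ j)) = (A :: 'a::comm_monoid_add^'n^'n)"
proof -
  have "(\<Sum>i\<in>UNIV. \<Sum>j\<in>UNIV. mat_unit i j (A $ i $ j)) $ k $ l = A $ k $ l" for k l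
  proof -
    have "(\<Sum>i\<in>UNIV. \<Sum>j\<in>UNIV. mat_unit i j (A $ i $ j)) $ k $ l
      = (\<Sum>i\<in>UNIV. \<Sum>j\<in>UNIV. if k = i then if l = j then A $ i $ j else 0 else 0)"
      by (simp add: mat_unit_def) (intro sum.cong refl, auto)
    also have "\<dots> = (\<Sum>i\<in>UNIV. if k = i then A $ i $ l else 0)"
      by (rule sum.cong) auto
    also have "\<dots> = A $ k $ l" by simp
    finally show ?thesis .
  qed
  then show ?thesis by (simp add: vec_eq_iff)
qed

lemma op_bound_exists: "\<exists>t. op_bound A t"
proof -
  have add: "\<exists>t. op_bound (sum f I) t" if "\<And>i. \<exists>t. op_bound (f i) t" "finite I"
    for f :: "'i \<Rightarrow> 'a::cstar_algebra^'n^'n" and I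
    using that(2)
  proof induction
    case empty
    have "op_bound (0 :: 'a^'n^'n) 1"
      by (simp add: op_bound_def vinner_self_positive)
        (simp add: vinner_def vinner_self_positive[unfolded vinner_def])
    then show ?case by auto
  next
    case (insert i I)
    then show ?case using that(1)[of i] op_bound_add by fastforce
  qed
  have "\<exists>t. op_bound (mat_unit i j (A $ i $ j)) t" for i j
    using op_bound_mat_unit[of "A $ i $ j" "norm (A $ i $ j) + 1" i j]
    by (metis less_add_one less_eq_real_def norm_ge_zero order_le_less_trans)
  then have "\<exists>t. op_bound (\<Sum>i\<in>UNIV. \<Sum>j\<in>UNIV. mat_unit i j (A $ i $ j)) t"
    by (intro add) auto
  then show ?thesis by (simp add: sum_mat_unit)
qed

lemma mat_norm_le: "op_bound A t \<Longrightarrow> mat_norm A \<le> t"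
  unfolding mat_norm_def by (rule cInf_lower) (auto intro!: bdd_belowI[of _ 0] dest: op_bound_pos)

lemma mat_norm_greatest: "(\<And>t. op_bound A t \<Longrightarrow> r \<le> t) \<Longrightarrow> r \<le> mat_norm A"
  unfolding mat_norm_def by (rule cInf_greatest) (use op_bound_exists in auto)

lemma mat_norm_approx:
  assumes "0 < e"
  obtains t where "op_bound A t" "t < mat_norm A + e"
proof -
  have "\<exists>t. op_bound A t \<and> t < mat_norm A + e"
  proof (rule ccontr)
    assume "\<not> ?thesis"
    then have "mat_norm A + e \<le> mat_norm A"
      by (intro mat_norm_greatest) force
    with assms show False by simp
  qed
  then show ?thesis using that by blast
qed

lemma mat_norm_nonneg: "0 \<le> mat_norm A"
  by (rule mat_norm_greatest) (auto dest: op_bound_pos)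

lemma mat_norm_entry: "norm (A $ i $ j) \<le> mat_norm A"
  by (rule mat_norm_greatest) (rule op_bound_entry)

lemma mat_norm_triangle: "mat_norm (A + B) \<le> mat_norm A + mat_norm B"
proof (rule field_le_epsilon)
  fix e :: real assume "0 < e"
  then have "0 < e / 2" by simp
  obtain s where s: "op_bound A s" "s < mat_norm A + e / 2"
    using mat_norm_approx[OF \<open>0 < e / 2\<close>] .
  obtain t where t: "op_bound B t" "t < mat_norm B + e / 2"
    using mat_norm_approx[OF \<open>0 < e / 2\<close>] .
  have "mat_norm (A + B) \<le> s + t"
    by (intro mat_norm_le op_bound_add s t)
  then show "mat_norm (A + B) \<le> mat_norm A + mat_norm B + e"
    using s(2) t(2) by simp
qed

lemma mat_norm_mult: "mat_norm (A ** B) \<le> mat_norm A * mat_norm B"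
proof -
  have *: "mat_norm (A ** B) \<le> s * t" if "op_bound A s" "op_bound B t" for s t
    using that op_bound_mult mat_norm_le by blast
  have q: "mat_norm (A ** B) / t \<le> mat_norm A" if "op_bound B t" for t
    using * that op_bound_pos[OF that] by (intro mat_norm_greatest) (auto simp: field_simps)
  then have **: "mat_norm (A ** B) \<le> mat_norm A * t" if "op_bound B t" for t
    using q[OF that] op_bound_pos[OF that] by (simp add: field_simps)
  show ?thesis
  proof (cases "mat_norm A = 0")
    case True
    then show ?thesis using ** op_bound_exists[of B] by auto
  next
    case False
    then have "0 < mat_norm A" using mat_norm_nonneg[of A] by simp
    moreover have "mat_norm (A ** B) / mat_norm A \<le> mat_norm B"
      using ** calculation by (intro mat_norm_greatest) (auto simp: field_simps)
    ultimately show ?thesis by (auto simp: field_simps)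
  qed
qed

lemma mat_norm_mat_unit: "mat_norm (mat_unit i j a) \<le> norm a"
proof (rule field_le_epsilon)
  fix e :: real assume "0 < e"
  then show "mat_norm (mat_unit i j a) \<le> norm a + e"
    by (intro mat_norm_le op_bound_mat_unit) (auto intro: add_nonneg_pos)
qed

lemma mat_norm_square_le: "(mat_norm A)\<^sup>2 \<le> mat_norm (mat_star A ** A)"
proof (rule mat_norm_greatest)
  fix u assume u: "op_bound (mat_star A ** A) u"
  then have "mat_norm A \<le> sqrt u" by (intro mat_norm_le op_bound_sqrt)
  then have "(mat_norm A)\<^sup>2 \<le> (sqrt u)\<^sup>2" using mat_norm_nonneg by (intro power_mono)
  then show "(mat_norm A)\<^sup>2 \<le> u" using op_bound_pos[OF u] by simp
qed

text \<open>
  Divide \<open>\<parallel>A\<parallel>\<^sup>2 \<le> \<parallel>A\<^sup>* A\<parallel> \<le> \<parallel>A\<^sup>*\<parallel> \<parallel>A\<parallel>\<close> by the norm of \<open>A\<close>. Applied to \<open>A\<^sup>*\<close> as well, this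
  makes the involution isometric.
\<close>

lemma mat_norm_le_mat_star: "mat_norm A \<le> mat_norm (mat_star A)"
proof (cases "mat_norm A = 0")
  case False
  have "mat_norm A * mat_norm A \<le> mat_norm (mat_star A) * mat_norm A"
    using mat_norm_square_le[of A] mat_norm_mult[of "mat_star A" A] by (simp add: power2_eq_square)
  then show ?thesis using False mat_norm_nonneg[of A] by simp
qed (simp add: mat_norm_nonneg)

lemma mat_norm_cstar: "mat_norm (mat_star A ** A) = (mat_norm A)\<^sup>2"
proof -
  have "mat_norm (mat_star A) = mat_norm A"
    using mat_norm_le_mat_star[of A] mat_norm_le_mat_star[of "mat_star A"] by simp
  then show ?thesis
    using mat_norm_square_le[of A] mat_norm_mult[of "mat_star A" A] by (simp add: power2_eq_square)
qed

definition mat_scale :: "complex \<Rightarrow> 'a::cstar_algebra^'n^'n \<Rightarrow> 'a^'n^'n"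
  where "mat_scale z A = (\<chi> i j. z *\<^sub>C A $ i $ j)"

lemma mat_norm_scale: "mat_norm (mat_scale z A) = cmod z * mat_norm (A :: 'a::cstar_algebra^'n^'n)"
proof (cases "z = 0")
  case True
  have "mat_norm (mat_unit undefined undefined 0 :: 'a^'n^'n) \<le> 0"
    using mat_norm_mat_unit[of undefined undefined "0::'a"] by simp
  moreover have "mat_scale z A = mat_unit undefined undefined 0"
    by (simp add: True mat_scale_def mat_unit_def vec_eq_iff)
  ultimately show ?thesis using True mat_norm_nonneg[of "mat_scale z A"] by simp
next
  case False
  have *: "mat_norm (mat_scale z A) \<le> cmod z * mat_norm A" if z: "z \<noteq> 0" for z and A :: "'a^'n^'n"
  proof -
    have "mat_norm (mat_scale z A) / cmod z \<le> mat_norm A"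
    proof (rule mat_norm_greatest)
      fix t assume t: "op_bound A t"
      have e: "mat_scale z A *v x = (\<chi> i. z *\<^sub>C (A *v x) $ i)" for x
        by (simp add: mat_scale_def matrix_vector_mult_def vec_eq_iff mult_scaleC_left
            scaleC.scale_sum_right)
      have e': "vinner (mat_scale z A *v x) (mat_scale z A *v x)
          = (cmod z)\<^sup>2 *\<^sub>R vinner (A *v x) (A *v x)" for x
        unfolding e vinner_def scaleR_scaleC
        by (simp add: star_scaleC mult_scaleC_left mult_scaleC_right scaleC_scaleC
           scaleC.scale_sum_right complex_norm_square mult.commute flip: of_real_power)
      have "positive ((cmod z)\<^sup>2 *\<^sub>R (t\<^sup>2 *\<^sub>R vinner x x - vinner (A *v x) (A *v x)))" for x
        using t by (intro positive_scaleR) (auto simp: op_bound_def)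
      then have "op_bound (mat_scale z A) (cmod z * t)"
        using z op_bound_pos[OF t] unfolding op_bound_def e'
        by (simp add: power_mult_distrib scaleR_right_diff_distrib)
      then show "mat_norm (mat_scale z A) / cmod z \<le> t"
        using z mat_norm_le by (fastforce simp: field_simps)
    qed
    then show ?thesis using z by (simp add: field_simps)
  qed
  have "mat_norm A = mat_norm (mat_scale (inverse z) (mat_scale z A))"
    using False by (simp add: mat_scale_def scaleC_scaleC scaleC_one)
  also have "\<dots> \<le> mat_norm (mat_scale z A) / cmod z"
    using *[of "inverse z" "mat_scale z A"] False by (simp add: norm_inverse divide_inverse mult.commute)
  finally have "cmod z * mat_norm A \<le> mat_norm (mat_scale z A)"
    using False by (simp add: field_simps)
  with *[OF False, of A] show ?thesis by simp
qed

lemma mat_norm_eq_0: "mat_norm A = 0 \<longleftrightarrow> A = 0"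
proof
  assume "mat_norm A = 0"
  then have "norm (A $ i $ j) \<le> 0" for i j using mat_norm_entry[of A i j] by simp
  then show "A = 0" by (simp add: vec_eq_iff)
next
  assume "A = 0"
  then show "mat_norm A = 0"
    using mat_norm_scale[of 0 A] by (simp add: mat_scale_def zero_vec_def)
qed

lemma mat_norm_one: "mat_norm (mat 1 :: 'a::cstar_algebra^'n^'n) = 1"
proof (rule antisym)
  have "positive (0::'a)" by (rule positive_0)
  then show "mat_norm (mat 1 :: 'a^'n^'n) \<le> 1"
    by (intro mat_norm_le) (simp add: op_bound_def)
  show "1 \<le> mat_norm (mat 1 :: 'a^'n^'n)"
    using mat_norm_entry[of "mat 1 :: 'a^'n^'n" undefined undefined] by (simp add: mat_def)
qed

section \<open>Square matrices form a C*-algebra\<close>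

text \<open>
  A copy of the square matrices, because the type \<open>'a^'n^'n\<close> already carries the componentwise
  product and a norm that in general is not a C*-norm.
\<close>

typedef (overloaded) ('a, 'n) cstar_matrix = "UNIV :: ('a::cstar_algebra^'n::finite^'n) set"
  morphisms entries of_entries ..

setup_lifting type_definition_cstar_matrix

instantiation cstar_matrix :: (cstar_algebra, finite) complex_star_algebra
begin

lift_definition zero_cstar_matrix :: "('a, 'b) cstar_matrix" is 0 .
lift_definition plus_cstar_matrix ::
    "('a, 'b) cstar_matrix \<Rightarrow> ('a, 'b) cstar_matrix \<Rightarrow> ('a, 'b) cstar_matrix"
  is "(+)" .
lift_definition minus_cstar_matrix ::
    "('a, 'b) cstar_matrix \<Rightarrow> ('a, 'b) cstar_matrix \<Rightarrow> ('a, 'b) cstar_matrix"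
  is "(-)" .
lift_definition uminus_cstar_matrix ::
    "('a, 'b) cstar_matrix \<Rightarrow> ('a, 'b) cstar_matrix"
  is uminus .
lift_definition times_cstar_matrix ::
    "('a, 'b) cstar_matrix \<Rightarrow> ('a, 'b) cstar_matrix \<Rightarrow> ('a, 'b) cstar_matrix"
  is "(**)" .
lift_definition scaleC_cstar_matrix ::
    "complex \<Rightarrow> ('a, 'b) cstar_matrix \<Rightarrow> ('a, 'b) cstar_matrix"
  is mat_scale .
lift_definition star_cstar_matrix :: "('a, 'b) cstar_matrix \<Rightarrow> ('a, 'b) cstar_matrix" is mat_star .

instance
proof
  fix x y z :: "('a, 'b) cstar_matrix" and c d :: complex
  show "x + y + z = x + (y + z)" "x + y = y + x" "0 + x = x" "- x + x = 0" "x - y = x + - y"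
    by (transfer; simp)+
  show "x * y * z = x * (y * z)"
    by transfer (simp add: matrix_mul_assoc)
  show "(x + y) * z = x * z + y * z"
    by transfer (simp add: matrix_matrix_mult_def vec_eq_iff distrib_right sum.distrib)
  show "x * (y + z) = x * y + x * z"
    by transfer (rule matrix_add_ldistrib)
  show "c *\<^sub>C (x + y) = c *\<^sub>C x + c *\<^sub>C y" "(c + d) *\<^sub>C x = c *\<^sub>C x + d *\<^sub>C x"
    "c *\<^sub>C (d *\<^sub>C x) = (c * d) *\<^sub>C x" "1 *\<^sub>C x = x"
    by (transfer; simp add: mat_scale_def vec_eq_iff scaleC_add_left scaleC_add_right
        scaleC_scaleC scaleC_one)+
  show "(c *\<^sub>C x) * y = c *\<^sub>C (x * y)" "x * (c *\<^sub>C y) = c *\<^sub>C (x * y)"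
    by (transfer; simp add: mat_scale_def vec_eq_iff matrix_matrix_mult_def mult_scaleC_left
      mult_scaleC_right scaleC.scale_sum_right)+
  show "star (star x) = x"
    by transfer simp
  show "star (x + y) = star x + star y" "star (c *\<^sub>C x) = cnj c *\<^sub>C star x"
    by (transfer; simp add: mat_scale_def mat_star_def vec_eq_iff star_add star_scaleC)+
  show "star (x * y) = star y * star x"
    by transfer (rule mat_star_matrix_mult)
qed

end

instantiation cstar_matrix :: (cstar_algebra, finite) real_algebra_1
begin

lift_definition one_cstar_matrix :: "('a, 'b) cstar_matrix" is "mat 1" .

definition scaleR_cstar_matrix :: "real \<Rightarrow> ('a, 'b) cstar_matrix \<Rightarrow> ('a, 'b) cstar_matrix"
  where "scaleR_cstar_matrix r x = of_real r *\<^sub>C x"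

instance
proof
  fix x y :: "('a, 'b) cstar_matrix" and r s :: real
  show "1 * x = x" "x * 1 = x"
    by (transfer; simp)+
  show "(0 :: ('a, 'b) cstar_matrix) \<noteq> 1"
    by transfer (simp add: mat_def vec_eq_iff)
  show "r *\<^sub>R (x + y) = r *\<^sub>R x + r *\<^sub>R y" "(r + s) *\<^sub>R x = r *\<^sub>R x + s *\<^sub>R x"
    "r *\<^sub>R s *\<^sub>R x = (r * s) *\<^sub>R x" "1 *\<^sub>R x = x"
    by (simp_all add: scaleR_cstar_matrix_def scaleC_add_left scaleC_add_right scaleC_scaleC scaleC_one)
  show "r *\<^sub>R x * y = r *\<^sub>R (x * y)" "x * r *\<^sub>R y = r *\<^sub>R (x * y)"
    by (simp_all add: scaleR_cstar_matrix_def mult_scaleC_left mult_scaleC_right)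
qed

end

instantiation cstar_matrix :: (cstar_algebra, finite) real_normed_algebra_1
begin

lift_definition norm_cstar_matrix :: "('a, 'b) cstar_matrix \<Rightarrow> real" is mat_norm .

definition sgn_cstar_matrix :: "('a, 'b) cstar_matrix \<Rightarrow> ('a, 'b) cstar_matrix"
  where "sgn_cstar_matrix x = x /\<^sub>R norm x"

definition dist_cstar_matrix :: "('a, 'b) cstar_matrix \<Rightarrow> ('a, 'b) cstar_matrix \<Rightarrow> real"
  where "dist_cstar_matrix x y = norm (x - y)"

definition uniformity_cstar_matrix :: "(('a, 'b) cstar_matrix \<times> ('a, 'b) cstar_matrix) filter"
  where "uniformity_cstar_matrix = (INF e\<in>{0 <..}. principal {(x, y). dist x y < e})"

definition open_cstar_matrix :: "('a, 'b) cstar_matrix set \<Rightarrow> bool"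
  where "open_cstar_matrix U \<longleftrightarrow>
    (\<forall>x\<in>U. eventually (\<lambda>(x', y). x' = x \<longrightarrow> y \<in> U) uniformity)"

instance
proof
  fix x y :: "('a, 'b) cstar_matrix" and r :: real
  show "norm (1 :: ('a, 'b) cstar_matrix) = 1"
    by transfer (rule mat_norm_one)
  show "norm x = 0 \<longleftrightarrow> x = 0"
    by transfer (rule mat_norm_eq_0)
  show "norm (x + y) \<le> norm x + norm y"
    by transfer (rule mat_norm_triangle)
  show "norm (r *\<^sub>R x) = \<bar>r\<bar> * norm x"
    unfolding scaleR_cstar_matrix_def by transfer (simp add: mat_norm_scale)
  show "norm (x * y) \<le> norm x * norm y"
    by transfer (rule mat_norm_mult)
qed (simp_all add: sgn_cstar_matrix_def dist_cstar_matrix_def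
    uniformity_cstar_matrix_def open_cstar_matrix_def)

end

text \<open>
  The norm lies between the largest entry and the sum of the entries in norm, so completeness
  is inherited entrywise.
\<close>

lemma entries_norm_le: "norm (entries x $ i $ j) \<le> norm x"
  by transfer (rule mat_norm_entry)

lemma norm_le_sum_entries:
  fixes x :: "('a::cstar_algebra, 'n::finite) cstar_matrix"
  shows "norm x \<le> (\<Sum>i\<in>UNIV. \<Sum>j\<in>UNIV. norm (entries x $ i $ j))"
proof -
  have "entries (\<Sum>i\<in>I. f i) = (\<Sum>i\<in>I. entries (f i))" for f :: "'n \<Rightarrow> ('a, 'n) cstar_matrix" and I
    by (induction I rule: infinite_finite_induct)
      (simp_all add: zero_cstar_matrix.rep_eq plus_cstar_matrix.rep_eq)
  then have "x = (\<Sum>i\<in>UNIV. \<Sum>j\<in>UNIV. of_entries (mat_unit i j (entries x $ i $ j)))"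
    by (simp add: entries_inject[symmetric] of_entries_inverse sum_mat_unit)
  then have "norm x = norm (\<Sum>i\<in>UNIV. \<Sum>j\<in>UNIV. of_entries (mat_unit i j (entries x $ i $ j)))"
    by simp
  also have "\<dots> \<le> (\<Sum>i\<in>UNIV. \<Sum>j\<in>UNIV. norm (of_entries (mat_unit i j (entries x $ i $ j))))"
    by (intro order_trans[OF norm_sum] sum_mono) simp
  also have "\<dots> \<le> (\<Sum>i\<in>UNIV. \<Sum>j\<in>UNIV. norm (entries x $ i $ j))"
    by (intro sum_mono) (simp add: norm_cstar_matrix.rep_eq of_entries_inverse mat_norm_mat_unit)
  finally show ?thesis .
qed

instance cstar_matrix :: (cstar_algebra, finite) cstar_algebra
proof
  fix X :: "nat \<Rightarrow> ('a, 'b) cstar_matrix"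
  assume X: "Cauchy X"
  have "convergent (\<lambda>n. entries (X n) $ i $ j)" for i j
  proof (rule Cauchy_convergent, rule metric_CauchyI)
    fix e :: real assume "0 < e"
    then obtain M where M: "\<And>m n. m \<ge> M \<Longrightarrow> n \<ge> M \<Longrightarrow> dist (X m) (X n) < e"
      using X unfolding Cauchy_def by blast
    have "dist (entries (X m) $ i $ j) (entries (X n) $ i $ j) \<le> dist (X m) (X n)" for m n
      using entries_norm_le[of "X m - X n" i j] by (simp add: dist_norm minus_cstar_matrix.rep_eq)
    then show "\<exists>M. \<forall>m\<ge>M. \<forall>n\<ge>M. dist (entries (X m) $ i $ j) (entries (X n) $ i $ j) < e"
      using M order_le_less_trans by blast
  qed
  then obtain L where L: "\<And>i j. (\<lambda>n. entries (X n) $ i $ j) \<longlonglongrightarrow> L i j"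
    unfolding convergent_def by metis
  define l :: "('a, 'b) cstar_matrix" where "l = of_entries (\<chi> i j. L i j)"
  have "(\<lambda>n. \<Sum>i\<in>UNIV. \<Sum>j\<in>UNIV. norm (entries (X n) $ i $ j - L i j))
      \<longlonglongrightarrow> (\<Sum>i\<in>(UNIV::'b set). \<Sum>j\<in>(UNIV::'b set). 0)"
    by (intro tendsto_sum tendsto_norm_zero LIM_zero L)
  then have lim: "(\<lambda>n. \<Sum>i\<in>UNIV. \<Sum>j\<in>UNIV. norm (entries (X n) $ i $ j - L i j)) \<longlonglongrightarrow> 0"
    by simp
  have "norm (X n - l) \<le> (\<Sum>i\<in>UNIV. \<Sum>j\<in>UNIV. norm (entries (X n) $ i $ j - L i j))" for n
    using norm_le_sum_entries[of "X n - l"]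
    by (simp add: l_def minus_cstar_matrix.rep_eq of_entries_inverse)
  then have "(\<lambda>n. X n - l) \<longlonglongrightarrow> 0"
    by (intro Lim_null_comparison[OF _ lim] always_eventually allI)
  then have "X \<longlonglongrightarrow> l" by (rule LIM_zero_cancel)
  then show "convergent X" by (auto simp: convergent_def)
next
  fix x :: "('a, 'b) cstar_matrix" and z :: complex and r :: real
  show "r *\<^sub>R x = complex_of_real r *\<^sub>C x" by (simp add: scaleR_cstar_matrix_def)
  show "norm (z *\<^sub>C x) = cmod z * norm x" by transfer (rule mat_norm_scale)
  show "norm (star x * x) = (norm x)\<^sup>2" by transfer (rule mat_norm_cstar)
qed

section \<open>Positive matrices and Gram matrices\<close>

lemma mat_positive_iff_positive:
  fixes A :: "'a::cstar_algebra^'n^'n"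
  shows "mat_positive A \<longleftrightarrow> positive (of_entries A)"
proof -
  have star: "star (of_entries A) = of_entries A \<longleftrightarrow> mat_star A = A"
    by (simp add: entries_inject[symmetric] star_cstar_matrix.rep_eq of_entries_inverse)
  have "entries (of_entries A - z *\<^sub>C 1) = A - mat (z *\<^sub>C 1)" for z
    by (simp add: minus_cstar_matrix.rep_eq scaleC_cstar_matrix.rep_eq one_cstar_matrix.rep_eq
        of_entries_inverse) (simp add: mat_scale_def mat_def vec_eq_iff)
  moreover have "(\<exists>b. x * b = 1 \<and> b * x = 1) \<longleftrightarrow> invertible (entries x)" for x :: "('a, 'n) cstar_matrix"
  proof -
    have "x * b = 1 \<and> b * x = 1 \<longleftrightarrow>
        entries x ** entries b = mat 1 \<and> entries b ** entries x = mat 1" for b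
      by (simp add: entries_inject[symmetric] times_cstar_matrix.rep_eq one_cstar_matrix.rep_eq)
    moreover have "\<exists>b. entries b = B" for B :: "'a^'n^'n"
      using of_entries_inverse[of B] by (metis UNIV_I)
    ultimately show ?thesis
      unfolding invertible_def by metis
  qed
  ultimately have "spectrum (of_entries A) = mat_spectrum A"
    by (simp add: spectrum_def mat_spectrum_def)
  with star show ?thesis by (simp add: positive_def mat_positive_def)
qed

lemma mat_positive_factorization:
  fixes R :: "'a::cstar_algebra^'n^'n"
  assumes "mat_positive R"
  shows "\<exists>X :: 'a^'n^'n. \<forall>i j. R $ i $ j = (\<Sum>k\<in>UNIV. star (X $ k $ i) * X $ k $ j)"
proof -
  obtain x where x: "positive x" "x * x = of_entries R"
    using positive_sqrt assms unfolding mat_positive_iff_positive by metis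
  have "R = entries (star x * x)"
    using x by (simp add: positive_star of_entries_inverse)
  also have "\<dots> = mat_star (entries x) ** entries x"
    by (simp add: times_cstar_matrix.rep_eq star_cstar_matrix.rep_eq)
  finally have "R $ i $ j = (\<Sum>k\<in>UNIV. star (entries x $ k $ i) * entries x $ k $ j)" for i j
    by (simp add: matrix_matrix_mult_def mat_star_def)
  then show ?thesis by blast
qed

text \<open>
  For fixed \<open>l\<close>, the inner sum is the entry at \<open>(i, j)\<close> of \<open>Z\<^sub>l\<^sup>* Z\<^sub>l\<close>.
\<close>

lemma mat_positive_gram:
  fixes M :: "'a::cstar_algebra^'n^'n" and Z :: "'l \<Rightarrow> 'n \<Rightarrow> 'n \<Rightarrow> 'a"
  assumes M: "\<And>i j. M $ i $ j = (\<Sum>l\<in>I. \<Sum>k\<in>UNIV. star (Z l k i) * Z l k j)"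
  shows "mat_positive M"
proof -
  let ?z = "\<lambda>l. of_entries (\<chi> k j. Z l k j)"
  have "entries (\<Sum>l\<in>I. f l) $ i $ j = (\<Sum>l\<in>I. entries (f l) $ i $ j)"
    for f :: "'l \<Rightarrow> ('a, 'n) cstar_matrix" and i j
    by (induction I rule: infinite_finite_induct)
      (simp_all add: zero_cstar_matrix.rep_eq plus_cstar_matrix.rep_eq)
  then have "entries (\<Sum>l\<in>I. star (?z l) * ?z l) = M"
    by (simp add: vec_eq_iff M times_cstar_matrix.rep_eq star_cstar_matrix.rep_eq of_entries_inverse
       matrix_matrix_mult_def mat_star_def)
  then have "of_entries M = (\<Sum>l\<in>I. star (?z l) * ?z l)"
    using entries_inverse[of "\<Sum>l\<in>I. star (?z l) * ?z l"] by simp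
  then show ?thesis
    unfolding mat_positive_iff_positive by (simp add: positive_sum positive_star_mult)
qed

text \<open>
  For fixed \<open>l\<close>, the sum over \<open>i\<close> and \<open>j\<close> factors as \<open>w\<^sup>* w\<close> with \<open>w = (\<Sum>j\<in>J. Z l j)\<close>.
\<close>

lemma positive_sum_gram:
  fixes Z :: "'l \<Rightarrow> 'i \<Rightarrow> 'a::cstar_algebra"
  shows "positive (\<Sum>i\<in>J. \<Sum>j\<in>J. \<Sum>l\<in>I. star (Z l i) * Z l j)"
proof -
  have "(\<Sum>i\<in>J. \<Sum>j\<in>J. \<Sum>l\<in>I. star (Z l i) * Z l j)
      = (\<Sum>i\<in>J. \<Sum>l\<in>I. \<Sum>j\<in>J. star (Z l i) * Z l j)"
    by (intro sum.cong refl sum.swap)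
  also have "\<dots> = (\<Sum>l\<in>I. \<Sum>i\<in>J. \<Sum>j\<in>J. star (Z l i) * Z l j)"
    by (rule sum.swap)
  also have "\<dots> = (\<Sum>l\<in>I. star (\<Sum>i\<in>J. Z l i) * (\<Sum>j\<in>J. Z l j))"
    by (simp add: star_sum sum_product)
  finally show ?thesis
    by (simp add: positive_sum positive_star_mult)
qed

section \<open>The tensorial Schur product\<close>

lemma pure_tensor_zero: "0 \<otimes> b = 0" "a \<otimes> 0 = 0"
  using pure_tensor_simps(1)[of 0 0 b] pure_tensor_simps(2)[of a 0 0] by simp_all

lemma pure_tensor_sum:
  fixes f :: "'i \<Rightarrow> 'a::complex_star_algebra" and g :: "'j \<Rightarrow> 'b::complex_star_algebra"
  shows "(\<Sum>k\<in>I. f k) \<otimes> (\<Sum>l\<in>J. g l) = (\<Sum>l\<in>J. \<Sum>k\<in>I. f k \<otimes> g l)"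
proof -
  have left: "(\<Sum>k\<in>I. f k) \<otimes> b = (\<Sum>k\<in>I. f k \<otimes> b)" for b :: 'b
    by (induction I rule: infinite_finite_induct) (simp_all add: pure_tensor_zero pure_tensor_simps)
  have "a \<otimes> (\<Sum>l\<in>J. g l) = (\<Sum>l\<in>J. a \<otimes> g l)" for a :: 'a
    by (induction J rule: infinite_finite_induct) (simp_all add: pure_tensor_zero pure_tensor_simps)
  then show ?thesis by (simp add: left)
qed

lemma star_hom_sum:
  assumes "star_hom \<phi>"
  shows "\<phi> (\<Sum>k\<in>I. f k) = (\<Sum>k\<in>I. \<phi> (f k))"
proof -
  have "\<phi> (0 + 0) = \<phi> 0 + \<phi> 0" using assms unfolding star_hom_def by blast
  then have "\<phi> 0 = 0" by simp
  then show ?thesis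
    using assms by (induction I rule: infinite_finite_induct) (simp_all add: star_hom_def)
qed

theorem proposition1p4:
  fixes \<iota> :: "('a::cstar_algebra, 'b::cstar_algebra) alg_tensor \<Rightarrow> 'c::cstar_algebra"
    and R :: "'a^'n^'n" and S :: "'b^'n^'n"
  assumes "star_hom \<iota>" and "inj \<iota>"
    and "mat_positive R" and "mat_positive S"
  shows "mat_positive (map_matrix \<iota> (R \<circ>\<^sup>\<otimes> S)) \<and>
    positive (\<Sum>i\<in>UNIV. \<Sum>j\<in>UNIV. \<iota> ((R $ i $ j) \<otimes> (S $ i $ j)))"
proof -
  obtain X :: "'a^'n^'n" where X: "\<And>i j. R $ i $ j = (\<Sum>k\<in>UNIV. star (X $ k $ i) * X $ k $ j)"
    using mat_positive_factorization[OF assms(3)] by blast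
  obtain Y :: "'b^'n^'n" where Y: "\<And>i j. S $ i $ j = (\<Sum>l\<in>UNIV. star (Y $ l $ i) * Y $ l $ j)"
    using mat_positive_factorization[OF assms(4)] by blast
  \<comment> \<open>Fixing an index of Y leaves a square block, so no rectangular factor occurs.\<close>
  define Z where "Z = (\<lambda>l k j. \<iota> ((X $ k $ j) \<otimes> (Y $ l $ j)))"
  have "\<iota> ((star a * a') \<otimes> (star b * b')) = star (\<iota> (a \<otimes> b)) * \<iota> (a' \<otimes> b')" for a a' b b'
  proof -
    have "(star a * a') \<otimes> (star b * b') = star (a \<otimes> b) * (a' \<otimes> b')"
      by (simp only: pure_tensor_simps(5,6))
    then show ?thesis
      using assms(1) by (simp add: star_hom_def)
  qed
  then have *: "\<iota> ((R $ i $ j) \<otimes> (S $ i $ j)) = (\<Sum>l\<in>UNIV. \<Sum>k\<in>UNIV. star (Z l k i) * Z l k j)" for i j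
    by (simp add: X Y Z_def pure_tensor_sum star_hom_sum[OF assms(1)])
  have "mat_positive (map_matrix \<iota> (R \<circ>\<^sup>\<otimes> S))"
    by (rule mat_positive_gram[where Z = Z and I = UNIV]) (simp add: tensor_schur_def *)
  moreover have "positive (\<Sum>i\<in>UNIV. \<Sum>j\<in>UNIV. \<iota> ((R $ i $ j) \<otimes> (S $ i $ j)))"
    using positive_sum_gram[of "\<lambda>(l, k). Z l k" "UNIV \<times> UNIV" UNIV]
    by (simp add: * sum.cartesian_product case_prod_beta)
  ultimately show ?thesis ..
qed

end
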